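(* Let $n\geqslant1$ and let $\Omega\subset\mathbb{H}^n$ be a domain with $\Omega\cap\{q_0=0\}=\emptyset$. Then for every $k\geqslant 0$ the following sequence of cohomology groups is (well defined and) exact: $$\begin{aligned} 0&\rightarrow H^0(\Omega,\mathcal{R}^{(k+2)})\xrightarrow{\widetilde{\mathcal{L}}_0^{(k)}}H^0\big(\Omega,\mathcal{R}^{(k+1)}\oplus \mathcal{R}^{(k+1)}\big)\xrightarrow{\mathcal{L}_0^{(k)}} H^0(\Omega,\mathcal{R}^{(k)})\xrightarrow{s_0^{(k)}} H^1(\Omega,\mathcal{R}^{(k+2)})\rightarrow \\ \cdots &\rightarrow H^k\big(\Omega,\mathcal{R}^{(k+1)}\oplus \mathcal{R}^{(k+1)}\big)\xrightarrow{\mathcal{L}_k^{(k)}} H^k(\Omega,\mathcal{R}^{(k)})\xrightarrow{s_k^{(k)}}H^{k+1}(\Omega,\mathcal{R}^{(k+2)})\\ &\xrightarrow{\widetilde{\mathcal{L}}_{k+1}^{(k)}} H^{k+1}\big(\Omega,\mathcal{R}^{(k+1)}\oplus \mathcal{R}^{(k+1)}\big). \end{aligned}$$ (The maps are $\widetilde{\mathcal L}_j^{(k)}$ for $0\leqslant j\leqslant k+1$, and $\mathcal L_j^{(k)}$, $s_j^{(k)}$ for $0\leqslant j\leqslant k$; exactness is at all terms except the last.)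
   Context: Identify $\mathbb{H}^n$ with $\mathbb{R}^{4n}$ via $q_t=x_{4t}+\mathbf{i}x_{4t+1}+\mathbf{j}x_{4t+2}+\mathbf{k}x_{4t+3}$, $t=0,\dots,n-1$. With $\partial_m=\partial/\partial x_m$ and $i\in\mathbb{C}$ the imaginary unit, put $\nabla_{2t}^{0'}=-\partial_{4t+2}-i\partial_{4t+3}$, $\nabla_{2t}^{1'}=-\partial_{4t}-i\partial_{4t+1}$, $\nabla_{2t+1}^{0'}=\partial_{4t}-i\partial_{4t+1}$, $\nabla_{2t+1}^{1'}=-\partial_{4t+2}+i\partial_{4t+3}$. Fix a basis $\omega^0,\dots,\omega^{2n-1}$ of $\mathbb{C}^{2n}$. For $A'\in\{0',1'\}$ and a smooth $\Lambda^p\mathbb{C}^{2n}$-valued function $f=\sum_I f_I\,\omega^I$ put $d^{A'}f=\sum_{A=0}^{2n-1}\sum_I\nabla_A^{A'}f_I\;\omega^A\wedge\omega^I$. Forms. For $m\geqslant0$ let $V_j^{(m)}=\odot^{m-j}\mathbb{C}^2\otimes\Lambda^j\mathbb{C}^{2n}$ for $0\leqslant j\leqslant m$ and $V_{m+1}^{(m)}=\Lambda^{m+2}\mathbb{C}^{2n}$ (exterior powers of degree $>2n$ are $0$; $\odot^0\mathbb{C}^2=\mathbb{C}$). Elements of $\odot^{p}\mathbb{C}^2\otimes\Lambda^j\mathbb{C}^{2n}$ are families $(f_{A_0'\cdots A_{p-1}'})$ of elements of $\Lambda^j\mathbb{C}^{2n}$, indices in $\{0',1'\}$, symmetric in the indices.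 The operators $\mathscr{D}_j^{(m)}:C^\infty(\Omega,V_j^{(m)})\to C^\infty(\Omega,V_{j+1}^{(m)})$ are $(\mathscr{D}_j^{(m)}f)_{\mathbf{A}'}=d^{0'}f_{0'\mathbf{A}'}+d^{1'}f_{1'\mathbf{A}'}$ for $0\leqslant j\leqslant m-1$ ($\mathbf{A}'$ a string of $m-j-1$ indices), and $\mathscr{D}_m^{(m)}f=d^{0'}d^{1'}f$. They form the beginning of a complex (the $m$-Cauchy–Fueter complex), which is an acyclic resolution of the sheaf $\mathcal{R}^{(m)}=\ker\mathscr{D}_0^{(m)}$ of $m$-regular functions. Accordingly, for $0\leqslant j\leqslant m$, $H^j(\Omega,\mathcal{R}^{(m)})$ is represented as $\ker\mathscr{D}_j^{(m)}/\operatorname{Im}\mathscr{D}_{j-1}^{(m)}$ on $\Omega$ (with $\operatorname{Im}\mathscr{D}_{-1}^{(m)}=0$); $H^j(\Omega,\mathcal{R}^{(m)}\oplus\mathcal{R}^{(m)})$ is the direct sum of two copies, with $\mathscr D$ acting componentwise. Maps. Put $z_{0}^{0'}=x_{2}+ix_{3}$, $z_{0}^{1'}=x_{0}+ix_{1}$, $z_{1}^{0'}=-x_{0}+ix_{1}$, $z_{1}^{1'}=x_{2}-ix_{3}$. For $0\leqslant j\leqslant k$, $\mathcal{L}_j^{(k)}:C^\infty(\Omega,V_j^{(k+1)}\oplus V_j^{(k+1)})\to C^\infty(\Omega,V_j^{(k)})$ is $(\mathcal{L}_j^{(k)}(f,g)^T)_{\mathbf{A}'}=z_0^{0'}f_{0'\mathbf{A}'}+z_0^{1'}f_{1'\mathbf{A}'}+z_1^{0'}g_{0'\mathbf{A}'}+z_1^{1'}g_{1'\mathbf{A}'}$.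 For $0\leqslant j\leqslant k+1$, $\widetilde{\mathcal{L}}_j^{(k)}:C^\infty(\Omega,V_j^{(k+2)})\to C^\infty(\Omega,V_j^{(k+1)}\oplus V_j^{(k+1)})$ is $(\widetilde{\mathcal{L}}_j^{(k)}h)_{\mathbf{A}'}=\bigl(-z_1^{0'}h_{0'\mathbf{A}'}-z_1^{1'}h_{1'\mathbf{A}'},\ z_0^{0'}h_{0'\mathbf{A}'}+z_0^{1'}h_{1'\mathbf{A}'}\bigr)^T$. The same symbols denote the induced maps on cohomology. For $0\leqslant j\leqslant k$, $s_j^{(k)}:H^j(\Omega,\mathcal{R}^{(k)})\to H^{j+1}(\Omega,\mathcal{R}^{(k+2)})$ is the connecting map: for $f\in\ker\mathscr{D}_j^{(k)}$ choose $u\in C^\infty(\Omega,V_j^{(k+1)}\oplus V_j^{(k+1)})$ with $\mathcal{L}_j^{(k)}u=f$; then $s_j^{(k)}[f]=[v]$, where $v\in C^\infty(\Omega,V_{j+1}^{(k+2)})$ is the element with $\widetilde{\mathcal{L}}_{j+1}^{(k)}v=\mathscr{D}_j^{(k+1)}u$. *)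

theory Defs
  imports "HOL-Analysis.Analysis" "HOL-Algebra.Coset" "HOL-Library.Multiset"
begin

text \<open>
  A point of \<open>\<real>\<^sup>N\<close> is a sequence \<open>x :: nat \<Rightarrow> real\<close> with \<open>x i = 0\<close> for \<open>i \<ge> N\<close>, as in
  \<^const>\<open>Euclidean_space\<close>; \<open>\<H>\<^sup>n\<close> is \<open>Euclidean_space (4 * n)\<close>, with
  \<open>q\<^sub>t = x (4*t) + \<i> x (4*t+1) + \<j> x (4*t+2) + \<k> x (4*t+3)\<close>. The topology of \<^const>\<open>Euclidean_space\<close>
  is the subspace topology of the product topology, which is also the one that
  \<^const>\<open>continuous_on\<close> uses on \<^typ>\<open>nat \<Rightarrow> real\<close>.
\<close>

type_synonym point = "nat \<Rightarrow> real"

definition pdiff :: "nat \<Rightarrow> (point \<Rightarrow> complex) \<Rightarrow> point \<Rightarrow> complex" where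
  "pdiff m f x = vector_derivative (\<lambda>s. f (x(m := s))) (at (x m))"

primrec iter_pdiff :: "nat list \<Rightarrow> (point \<Rightarrow> complex) \<Rightarrow> point \<Rightarrow> complex" where
  "iter_pdiff [] f = f"
| "iter_pdiff (m # ms) f = pdiff m (iter_pdiff ms f)"

definition smooth_fun :: "nat \<Rightarrow> point set \<Rightarrow> (point \<Rightarrow> complex) \<Rightarrow> bool" where
  "smooth_fun N \<Omega> f \<longleftrightarrow>
     (\<forall>ms. set ms \<subseteq> {..<N} \<longrightarrow>
        continuous_on \<Omega> (iter_pdiff ms f) \<and>
        (\<forall>m<N. \<forall>x\<in>\<Omega>. (\<lambda>s. iter_pdiff ms f (x(m := s))) differentiable (at (x m))))"

datatype primed = P0 | P1

text \<open>
  An element \<open>\<Sum>\<^sub>I a\<^sub>I \<omega>\<^sup>I\<close> of the exterior algebra of \<open>\<complex>\<^sup>2\<^sup>n\<close> is given by its coefficients \<open>a\<^sub>I\<close>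
  with respect to the chosen basis, where \<open>\<omega>\<^sup>I\<close> is the product of the \<open>\<omega>\<^sup>A\<close>, \<open>A \<in> I\<close>, in
  increasing order.
\<close>

type_synonym ext = "nat set \<Rightarrow> complex"

definition basis_form :: "nat set \<Rightarrow> ext" where
  "basis_form I = (\<lambda>J. if J = I then 1 else 0)"

text \<open>The sign is that of the permutation sorting \<open>I\<close> followed by \<open>K - I\<close>.\<close>

definition wedge :: "ext \<Rightarrow> ext \<Rightarrow> ext" where
  "wedge a b = (\<lambda>K. \<Sum>I\<in>Pow K.
     (-1) ^ card {(p, q). p \<in> I \<and> q \<in> K - I \<and> q < p} * a I * b (K - I))"

text \<open>A family \<open>(f\<^sub>A\<^sub>1\<^sub>.\<^sub>.\<^sub>.\<^sub>A\<^sub>p)\<close> of forms, indexed by strings of primed indices.\<close>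

type_synonym symext = "primed list \<Rightarrow> ext"

definition sym_ext_space :: "nat \<Rightarrow> nat \<Rightarrow> nat \<Rightarrow> symext set" where
  "sym_ext_space n p d =
     {w. (\<forall>As I. w As I \<noteq> 0 \<longrightarrow> length As = p \<and> I \<subseteq> {..<2 * n} \<and> card I = d) \<and>
         (\<forall>As Bs. mset As = mset Bs \<longrightarrow> w As = w Bs)}"

text \<open>Only used for \<open>j \<le> m + 1\<close>; for \<open>j = m + 1\<close> the only index string is the empty one.\<close>

definition CF_space :: "nat \<Rightarrow> nat \<Rightarrow> nat \<Rightarrow> symext set" where
  "CF_space n m j = (if j \<le> m then sym_ext_space n (m - j) j else sym_ext_space n 0 (m + 2))"

text \<open>
  A function on \<open>\<Omega>\<close> is represented by its extension by zero, so that two functions on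
  \<open>\<Omega>\<close> are equal iff their representatives are.
\<close>

definition smooth_sections :: "nat \<Rightarrow> point set \<Rightarrow> symext set \<Rightarrow> (point \<Rightarrow> symext) set" where
  "smooth_sections n \<Omega> W =
     {f. (\<forall>x\<in>\<Omega>. f x \<in> W) \<and> (\<forall>x. x \<notin> \<Omega> \<longrightarrow> f x = (\<lambda>_ _. 0)) \<and>
         (\<forall>As I. smooth_fun (4 * n) \<Omega> (\<lambda>x. f x As I))}"

definition nabla :: "nat \<Rightarrow> primed \<Rightarrow> (point \<Rightarrow> complex) \<Rightarrow> point \<Rightarrow> complex" where
  "nabla A P f x =
     (let t = A div 2 in
      case P of
        P0 \<Rightarrow> if even A then - pdiff (4 * t + 2) f x - \<i> * pdiff (4 * t + 3) f x
              else pdiff (4 * t) f x - \<i> * pdiff (4 * t + 1) f x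
      | P1 \<Rightarrow> if even A then - pdiff (4 * t) f x - \<i> * pdiff (4 * t + 1) f x
              else - pdiff (4 * t + 2) f x + \<i> * pdiff (4 * t + 3) f x)"

definition d_op :: "nat \<Rightarrow> primed \<Rightarrow> (point \<Rightarrow> ext) \<Rightarrow> point \<Rightarrow> ext" where
  "d_op n P f = (\<lambda>x K. \<Sum>A<2 * n. \<Sum>I\<in>Pow {..<2 * n}.
     nabla A P (\<lambda>y. f y I) x * wedge (basis_form {A}) (basis_form I) K)"

definition CF_op ::
  "nat \<Rightarrow> point set \<Rightarrow> nat \<Rightarrow> nat \<Rightarrow> (point \<Rightarrow> symext) \<Rightarrow> point \<Rightarrow> symext" where
  "CF_op n \<Omega> m j f = (\<lambda>x As K.
     if x \<notin> \<Omega> then 0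
     else if j < m then d_op n P0 (\<lambda>y. f y (P0 # As)) x K + d_op n P1 (\<lambda>y. f y (P1 # As)) x K
     else d_op n P0 (d_op n P1 (\<lambda>y. f y As)) x K)"

definition cocycles :: "nat \<Rightarrow> point set \<Rightarrow> nat \<Rightarrow> nat \<Rightarrow> (point \<Rightarrow> symext) monoid" where
  "cocycles n \<Omega> m j =
     \<lparr>carrier = {f \<in> smooth_sections n \<Omega> (CF_space n m j). CF_op n \<Omega> m j f = (\<lambda>_ _ _. 0)},
      mult = (\<lambda>f g x As I. f x As I + g x As I),
      one = (\<lambda>_ _ _. 0)\<rparr>"

definition coboundaries :: "nat \<Rightarrow> point set \<Rightarrow> nat \<Rightarrow> nat \<Rightarrow> (point \<Rightarrow> symext) set" where
  "coboundaries n \<Omega> m j =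
     (if j = 0 then {\<lambda>_ _ _. 0}
      else CF_op n \<Omega> m (j - 1) ` smooth_sections n \<Omega> (CF_space n m (j - 1)))"

text \<open>\<open>H\<^sup>j(\<Omega>, \<R>\<^sup>(\<^sup>m\<^sup>))\<close> for \<open>j \<le> m\<close>.\<close>

definition cohom :: "nat \<Rightarrow> point set \<Rightarrow> nat \<Rightarrow> nat \<Rightarrow> (point \<Rightarrow> symext) set monoid" where
  "cohom n \<Omega> m j = cocycles n \<Omega> m j Mod coboundaries n \<Omega> m j"

definition coh_class ::
  "nat \<Rightarrow> point set \<Rightarrow> nat \<Rightarrow> nat \<Rightarrow> (point \<Rightarrow> symext) \<Rightarrow> (point \<Rightarrow> symext) set" where
  "coh_class n \<Omega> m j f = coboundaries n \<Omega> m j #>\<^bsub>cocycles n \<Omega> m j\<^esub> f"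

definition cohom2 ::
  "nat \<Rightarrow> point set \<Rightarrow> nat \<Rightarrow> nat \<Rightarrow> ((point \<Rightarrow> symext) set \<times> (point \<Rightarrow> symext) set) monoid" where
  "cohom2 n \<Omega> m j = cohom n \<Omega> m j \<times>\<times> cohom n \<Omega> m j"

definition coh_class2 ::
  "nat \<Rightarrow> point set \<Rightarrow> nat \<Rightarrow> nat \<Rightarrow> (point \<Rightarrow> symext) \<times> (point \<Rightarrow> symext) \<Rightarrow>
     (point \<Rightarrow> symext) set \<times> (point \<Rightarrow> symext) set" where
  "coh_class2 n \<Omega> m j u = (coh_class n \<Omega> m j (fst u), coh_class n \<Omega> m j (snd u))"

text \<open>\<open>z\<^sub>A\<^sup>A\<^sup>'\<close> for \<open>A \<in> {0, 1}\<close>.\<close>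

definition z_coord :: "nat \<Rightarrow> primed \<Rightarrow> point \<Rightarrow> complex" where
  "z_coord A P x =
     (case P of
        P0 \<Rightarrow> if A = 0 then x 2 + \<i> * x 3 else - x 0 + \<i> * x 1
      | P1 \<Rightarrow> if A = 0 then x 0 + \<i> * x 1 else x 2 - \<i> * x 3)"

text \<open>
  The maps on sections are given by the same formula in every degree. They are
  pointwise linear, hence preserve extensions by zero.
\<close>

definition L_map :: "(point \<Rightarrow> symext) \<times> (point \<Rightarrow> symext) \<Rightarrow> point \<Rightarrow> symext" where
  "L_map u = (\<lambda>x As I.
     z_coord 0 P0 x * fst u x (P0 # As) I + z_coord 0 P1 x * fst u x (P1 # As) I +
     z_coord 1 P0 x * snd u x (P0 # As) I + z_coord 1 P1 x * snd u x (P1 # As) I)"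

definition Lt_map :: "(point \<Rightarrow> symext) \<Rightarrow> (point \<Rightarrow> symext) \<times> (point \<Rightarrow> symext)" where
  "Lt_map h =
     ((\<lambda>x As I. - z_coord 1 P0 x * h x (P0 # As) I - z_coord 1 P1 x * h x (P1 # As) I),
      (\<lambda>x As I. z_coord 0 P0 x * h x (P0 # As) I + z_coord 0 P1 x * h x (P1 # As) I))"

text \<open>
  The maps on cohomology: each is the unique element of the set of classes obtained
  from all choices of representatives (and of auxiliary data), and is unspecified
  if these choices do not all give the same class.
\<close>

definition L_coh ::
  "nat \<Rightarrow> point set \<Rightarrow> nat \<Rightarrow> nat \<Rightarrow>
     (point \<Rightarrow> symext) set \<times> (point \<Rightarrow> symext) set \<Rightarrow> (point \<Rightarrow> symext) set" where
  "L_coh n \<Omega> k j c = the_elem ((\<lambda>u. coh_class n \<Omega> k j (L_map u)) ` (fst c \<times> snd c))"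

definition Lt_coh ::
  "nat \<Rightarrow> point set \<Rightarrow> nat \<Rightarrow> nat \<Rightarrow>
     (point \<Rightarrow> symext) set \<Rightarrow> (point \<Rightarrow> symext) set \<times> (point \<Rightarrow> symext) set" where
  "Lt_coh n \<Omega> k j c = the_elem ((\<lambda>h. coh_class2 n \<Omega> (k + 1) j (Lt_map h)) ` c)"

text \<open>\<open>u\<close> is a lift of \<open>f\<close> as in the definition of the connecting map, and \<open>v\<close> is
  obtained from \<open>u\<close>.\<close>

definition is_lift ::
  "nat \<Rightarrow> point set \<Rightarrow> nat \<Rightarrow> nat \<Rightarrow> (point \<Rightarrow> symext) \<Rightarrow>
     (point \<Rightarrow> symext) \<times> (point \<Rightarrow> symext) \<Rightarrow> bool" where
  "is_lift n \<Omega> k j f u \<longleftrightarrow>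
     u \<in> smooth_sections n \<Omega> (CF_space n (k + 1) j) \<times> smooth_sections n \<Omega> (CF_space n (k + 1) j) \<and> L_map u = f"

definition is_descent ::
  "nat \<Rightarrow> point set \<Rightarrow> nat \<Rightarrow> nat \<Rightarrow> (point \<Rightarrow> symext) \<times> (point \<Rightarrow> symext) \<Rightarrow>
     (point \<Rightarrow> symext) \<Rightarrow> bool" where
  "is_descent n \<Omega> k j u v \<longleftrightarrow>
     v \<in> smooth_sections n \<Omega> (CF_space n (k + 2) (j + 1)) \<and>
     Lt_map v = (CF_op n \<Omega> (k + 1) j (fst u), CF_op n \<Omega> (k + 1) j (snd u))"

definition s_coh ::
  "nat \<Rightarrow> point set \<Rightarrow> nat \<Rightarrow> nat \<Rightarrow> (point \<Rightarrow> symext) set \<Rightarrow> (point \<Rightarrow> symext) set" where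
  "s_coh n \<Omega> k j c =
     the_elem {coh_class n \<Omega> (k + 2) (j + 1) v | f u v.
       f \<in> c \<and> is_lift n \<Omega> k j f u \<and> is_descent n \<Omega> k j u v}"

end

theory Submission
  imports Defs "HOL-Library.Function_Algebras"
begin

text \<open>
  In degrees \<open>j \<le> k\<close> the maps \<open>Lt\<close> and \<open>L\<close> form a short exact sequence
  \<open>0 \<rightarrow> V\<^sub>j\<^sup>(\<^sup>k\<^sup>+\<^sup>2\<^sup>) \<rightarrow> V\<^sub>j\<^sup>(\<^sup>k\<^sup>+\<^sup>1\<^sup>) \<oplus> V\<^sub>j\<^sup>(\<^sup>k\<^sup>+\<^sup>1\<^sup>) \<rightarrow> V\<^sub>j\<^sup>(\<^sup>k\<^sup>) \<rightarrow> 0\<close> of sections, split over \<open>\<Omega>\<close> because the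
  \<open>2 \<times> 2\<close> matrix of the \<open>z\<^sub>A\<^sup>A\<^sup>'\<close> has determinant \<open>\<bar>q\<^sub>0\<bar>\<^sup>2 \<noteq> 0\<close>; in degree \<open>k + 1\<close> the map \<open>Lt\<close> is
  bijective. Both maps commute with the first-order operators, since \<open>d\<^sup>A\<^sup>'z\<^sub>A\<^sup>B\<^sup>'\<close> is antisymmetric in
  \<open>A', B'\<close>. This gives the long exact sequence except where the second-order operator enters.
  There the missing ingredient is the identity
  \<open>d\<^sup>0\<^sup>'d\<^sup>1\<^sup>'(L u) = \<bar>q\<^sub>0\<bar>\<^sup>2 (d\<^sup>0\<^sup>'v\<^sub>0\<^sub>' + d\<^sup>1\<^sup>'v\<^sub>1\<^sub>')\<close> whenever \<open>Lt v = D u\<close>, by which \<open>L u\<close> is closed iff \<open>v\<close> is.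
\<close>

section \<open>Smooth functions of finitely many coordinates\<close>

text \<open>The snake lemma does not cover degree k: there the quotient complex goes on with the
  second-order operator into V_{k+1}^{(k)} = \<Lambda>^{k+2}, although Lt is already bijective in
  degree k+1 and leaves no cokernel. What replaces the missing square is the coincidence
  V_{k+2}^{(k+2)} = \<Lambda>^{k+2} = V_{k+1}^{(k)}: closedness of L u and of v are equations in the
  same space, and the quoted identity makes them proportional, with a factor that vanishes nowhere
  on \<Omega>.

  The identity holds because d^{0'}d^{1'} of a contraction of a family h with z involves h only
  through D h: each d^{A'} squares to zero and the two anticommute, so d^{0'}d^{1'}h_{0'} =
  -d^{1'}(D h) and d^{0'}d^{1'}h_{1'} = d^{0'}(D h). With D u = Lt v only first derivatives of v
  remain, and all terms with derivatives of z cancel.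

  The lift u in the connecting map is not unique, so maps on cohomology are treated as induced by
  additive relations between representatives, not by functions.\<close>

primrec Ck :: "nat \<Rightarrow> nat \<Rightarrow> point set \<Rightarrow> (point \<Rightarrow> complex) \<Rightarrow> bool" where
  "Ck 0 N \<Omega> f \<longleftrightarrow> continuous_on \<Omega> f"
| "Ck (Suc r) N \<Omega> f \<longleftrightarrow> continuous_on \<Omega> f \<and>
     (\<forall>m<N. (\<forall>x\<in>\<Omega>. (\<lambda>s. f (x(m := s))) differentiable (at (x m))) \<and> Ck r N \<Omega> (pdiff m f))"

lemma iter_pdiff_snoc: "iter_pdiff (ms @ [m]) f = iter_pdiff ms (pdiff m f)"
  by (induction ms) auto

lemma smooth_fun_pdiff:
  assumes "smooth_fun N \<Omega> f" "m < N"
  shows "smooth_fun N \<Omega> (pdiff m f)"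
  unfolding smooth_fun_def
proof (intro allI impI)
  fix ms assume "set ms \<subseteq> {..<N}"
  then have "set (ms @ [m]) \<subseteq> {..<N}" using assms(2) by auto
  then show "continuous_on \<Omega> (iter_pdiff ms (pdiff m f)) \<and>
      (\<forall>l<N. \<forall>x\<in>\<Omega>. (\<lambda>s. iter_pdiff ms (pdiff m f) (x(l := s))) differentiable (at (x l)))"
    using assms(1) iter_pdiff_snoc[of ms m f] unfolding smooth_fun_def by metis
qed

lemma smooth_fun_continuous: "smooth_fun N \<Omega> f \<Longrightarrow> continuous_on \<Omega> f"
  unfolding smooth_fun_def by (drule spec[of _ "[]"]) simp

lemma smooth_fun_differentiable:
  "smooth_fun N \<Omega> f \<Longrightarrow> m < N \<Longrightarrow> x \<in> \<Omega> \<Longrightarrow> (\<lambda>s. f (x(m := s))) differentiable (at (x m))"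
  unfolding smooth_fun_def by (drule spec[of _ "[]"]) simp

lemma smooth_fun_Ck: "smooth_fun N \<Omega> f \<Longrightarrow> Ck r N \<Omega> f"
proof (induction r arbitrary: f)
  case 0
  then show ?case by (simp add: smooth_fun_continuous)
next
  case (Suc r)
  then show ?case
    by (simp add: smooth_fun_continuous smooth_fun_differentiable smooth_fun_pdiff)
qed

text \<open>\<open>iter_pdiff\<close> adds derivatives on the outside, \<open>Ck\<close> takes the
  first one on the inside. The second form suits the product and quotient rules, which express first
  derivatives through functions of one order less, so that the closure lemmas become inductions on
  the order.\<close>

lemma smooth_fun_iff_Ck: "smooth_fun N \<Omega> f \<longleftrightarrow> (\<forall>r. Ck r N \<Omega> f)"
proof (intro iffI allI)
  assume C: "\<forall>r. Ck r N \<Omega> f"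
  have "continuous_on \<Omega> (iter_pdiff ms f) \<and>
      (\<forall>m<N. \<forall>x\<in>\<Omega>. (\<lambda>s. iter_pdiff ms f (x(m := s))) differentiable (at (x m)))"
    if "set ms \<subseteq> {..<N}" for ms
    using C that
  proof (induction ms arbitrary: f rule: rev_induct)
    case Nil
    then have "Ck (Suc 0) N \<Omega> f" by blast
    then show ?case by (simp del: fun_upd_apply)
  next
    case (snoc m ms)
    have "Ck r N \<Omega> (pdiff m f)" for r
      using spec[OF snoc.prems(1), of "Suc r"] snoc.prems(2) by simp
    then show ?case
      using snoc.IH[of "pdiff m f"] snoc.prems(2) by (simp add: iter_pdiff_snoc)
  qed
  then show "smooth_fun N \<Omega> f" unfolding smooth_fun_def by blast
qed (rule smooth_fun_Ck)

lemma Ck_mono: "Ck (Suc r) N \<Omega> f \<Longrightarrow> Ck r N \<Omega> f"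
  by (induction r arbitrary: f) auto

lemma has_pdiff:
  assumes "(\<lambda>s. f (x(m := s))) differentiable (at (x m))"
  shows "((\<lambda>s. f (x(m := s))) has_vector_derivative pdiff m f x) (at (x m))"
  unfolding pdiff_def using assms vector_derivative_works by blast

lemma pdiff_eqI:
  "((\<lambda>s. f (x(m := s))) has_vector_derivative c) (at (x m)) \<Longrightarrow> pdiff m f x = c"
  unfolding pdiff_def by (rule vector_derivative_at)

lemma pdiff_const [simp]: "pdiff m (\<lambda>x. c) = (\<lambda>x. 0)"
  by (rule ext, rule pdiff_eqI) simp

lemma pdiff_coord [simp]:
  "pdiff m (\<lambda>x. complex_of_real (x i)) = (\<lambda>x. if i = m then 1 else 0)"
proof (rule ext, rule pdiff_eqI)
  fix x :: point
  have "(complex_of_real has_vector_derivative 1) (at (x m))"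
    using has_vector_derivative_of_real[OF DERIV_ident] by simp
  then show "((\<lambda>s. complex_of_real ((x(m := s)) i)) has_vector_derivative (if i = m then 1 else 0)) (at (x m))"
    by (cases "i = m") simp_all
qed

lemma Ck_const [simp]: "Ck r N \<Omega> (\<lambda>x. c)"
  by (induction r arbitrary: c) auto

lemma differentiable_coord:
  "(\<lambda>s. complex_of_real ((x(m := s)) i)) differentiable (at (a :: real))"
  by (cases "i = m") (simp_all add: bounded_linear_of_real bounded_linear_imp_differentiable)

lemma smooth_fun_const [simp]: "smooth_fun N \<Omega> (\<lambda>x. c)"
  by (simp add: smooth_fun_iff_Ck)

lemma smooth_fun_coord [simp]: "smooth_fun N \<Omega> (\<lambda>x. complex_of_real (x i))"
  unfolding smooth_fun_iff_Ck
proof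
  fix r show "Ck r N \<Omega> (\<lambda>x. complex_of_real (x i))"
    by (induction r)
      (auto intro!: continuous_intros continuous_on_product_then_coordinatewise
        simp: differentiable_coord simp del: fun_upd_apply)
qed

lemma pdiff_add:
  assumes "(\<lambda>s. f (x(m := s))) differentiable (at (x m))"
    "(\<lambda>s. g (x(m := s))) differentiable (at (x m))"
  shows "pdiff m (\<lambda>x. f x + g x) x = pdiff m f x + pdiff m g x"
  by (rule pdiff_eqI) (auto intro!: derivative_intros has_pdiff assms)

lemma pdiff_mult:
  assumes "(\<lambda>s. f (x(m := s))) differentiable (at (x m))"
    "(\<lambda>s. g (x(m := s))) differentiable (at (x m))"
  shows "pdiff m (\<lambda>x. f x * g x) x = pdiff m f x * g x + f x * pdiff m g x"
  by (rule pdiff_eqI)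
    (rule has_vector_derivative_eq_rhs[OF has_vector_derivative_mult[OF has_pdiff[OF assms(1)] has_pdiff[OF assms(2)]]],
      simp)

lemma pdiff_inverse:
  assumes "(\<lambda>s. f (x(m := s))) differentiable (at (x m))" "f x \<noteq> 0"
  shows "((\<lambda>s. inverse (f (x(m := s)))) has_vector_derivative
    - (pdiff m f x * inverse (f x) * inverse (f x))) (at (x m))"
proof -
  have "(inverse has_field_derivative - (inverse (f x) * inverse (f x))) (at (f x))"
    using assms(2) by (auto intro!: derivative_eq_intros)
  then have "(inverse has_field_derivative - (inverse (f x) * inverse (f x))) (at (f (x(m := x m))))"
    by simp
  from field_vector_diff_chain_at[OF has_pdiff[OF assms(1)] this]
  show ?thesis unfolding o_def by (rule has_vector_derivative_eq_rhs) simp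
qed

locale region =
  fixes N :: nat and \<Omega> :: "point set"
  assumes openin_region: "openin (Euclidean_space N) \<Omega>"
begin

text \<open>\<Omega> is open only relative to the points whose coordinates vanish from N on.
  Changing coordinates below N stays among these, so an open T pulled back to the (s, t)-plane
  yields a whole square. Two free coordinates serve the symmetry of mixed derivatives; m = l is
  allowed and gives the one-coordinate case.\<close>

lemma box_in_region:
  assumes "x \<in> \<Omega>" "m < N" "l < N"
  obtains e where "e > 0"
    "\<And>s t. \<bar>s - x m\<bar> < e \<Longrightarrow> \<bar>t - x l\<bar> < e \<Longrightarrow> x(m := s, l := t) \<in> \<Omega>"
proof -
  obtain T where T: "open T" "\<Omega> = T \<inter> {x. \<forall>i\<ge>N. x i = 0}"
    using openin_region unfolding Euclidean_space_def euclidean_product_topology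
    by (auto simp: openin_subtopology)
  have "continuous_on UNIV (\<lambda>p :: real \<times> real. x(m := fst p, l := snd p))"
    by (rule continuous_on_coordinatewise_then_product, rename_tac i, case_tac "i = l"; case_tac "i = m")
      (auto intro!: continuous_intros)
  then have "open ((\<lambda>p :: real \<times> real. x(m := fst p, l := snd p)) -` T)"
    using T(1) by (simp add: open_vimage)
  moreover have "(x m, x l) \<in> (\<lambda>p :: real \<times> real. x(m := fst p, l := snd p)) -` T"
    using assms(1) T(2) by simp
  ultimately obtain A B where AB: "open A" "open B" "(x m, x l) \<in> A \<times> B"
    "A \<times> B \<subseteq> (\<lambda>p :: real \<times> real. x(m := fst p, l := snd p)) -` T"
    by (rule open_prod_elim)
  obtain d where d: "d > 0" "\<And>s. \<bar>s - x m\<bar> < d \<Longrightarrow> s \<in> A"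
    using AB(1,3) unfolding open_dist by (auto simp: dist_real_def)
  obtain e where e: "e > 0" "\<And>s. \<bar>s - x l\<bar> < e \<Longrightarrow> s \<in> B"
    using AB(2,3) unfolding open_dist by (auto simp: dist_real_def)
  show ?thesis
  proof (rule that[of "min d e"])
    fix s t assume "\<bar>s - x m\<bar> < min d e" "\<bar>t - x l\<bar> < min d e"
    then have "(s, t) \<in> A \<times> B" using d(2) e(2) by auto
    then have "x(m := s, l := t) \<in> T" using AB(4) by auto
    moreover have "x i = 0" if "i \<ge> N" for i using assms(1) T(2) that by auto
    ultimately show "x(m := s, l := t) \<in> \<Omega>" using T(2) assms(2,3) by auto
  qed (use d e in auto)
qed

lemma eventually_upd_in_region:
  assumes "x \<in> \<Omega>" "m < N"
  shows "\<forall>\<^sub>F s in nhds (x m). x(m := s) \<in> \<Omega>"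
proof -
  obtain e where "e > 0" "\<And>s t. \<bar>s - x m\<bar> < e \<Longrightarrow> \<bar>t - x m\<bar> < e \<Longrightarrow> x(m := s, m := t) \<in> \<Omega>"
    using box_in_region[OF assms assms(2)] by metis
  then show ?thesis
    by (auto simp: eventually_nhds_metric dist_real_def)
qed

lemma has_vector_derivative_cong_region:
  assumes "\<And>y. y \<in> \<Omega> \<Longrightarrow> f y = g y" "x \<in> \<Omega>" "m < N"
    and "((\<lambda>s. f (x(m := s))) has_vector_derivative c) (at (x m))"
  shows "((\<lambda>s. g (x(m := s))) has_vector_derivative c) (at (x m))"
proof -
  have "\<forall>\<^sub>F s in nhds (x m). f (x(m := s)) = g (x(m := s))"
    using eventually_upd_in_region[OF assms(2,3)] by eventually_elim (simp add: assms(1))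
  then show ?thesis
    using assms(4) has_vector_derivative_cong_ev[of UNIV "\<lambda>s. f (x(m := s))" "\<lambda>s. g (x(m := s))" "x m" c]
      assms(1,2) by simp
qed

lemma pdiff_cong:
  assumes "\<And>y. y \<in> \<Omega> \<Longrightarrow> f y = g y" "x \<in> \<Omega>" "m < N"
  shows "pdiff m f x = pdiff m g x"
proof -
  \<comment> \<open>\<open>vector_derivative\<close> is a choice among the derivatives, so equal
    sets of derivatives give equal values, differentiable or not.\<close>
  have "((\<lambda>s. f (x(m := s))) has_vector_derivative c) (at (x m)) \<longleftrightarrow>
      ((\<lambda>s. g (x(m := s))) has_vector_derivative c) (at (x m))" for c
    using has_vector_derivative_cong_region[of f g x m c]
      has_vector_derivative_cong_region[of g f x m c] assms by auto
  then show ?thesis unfolding pdiff_def vector_derivative_def by simp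
qed

text \<open>The differentiation rules give formulas for partial derivatives at the points of
  \<Omega> only; this carries regularity over from the formula to the derivative itself.\<close>

lemma Ck_cong:
  assumes "\<And>y. y \<in> \<Omega> \<Longrightarrow> f y = g y" "Ck r N \<Omega> f"
  shows "Ck r N \<Omega> g"
  using assms
proof (induction r arbitrary: f g)
  case 0
  then show ?case using continuous_on_cong[of \<Omega> \<Omega> f g] by simp
next
  case (Suc r)
  have "(\<lambda>s. g (x(m := s))) differentiable (at (x m))" if "x \<in> \<Omega>" "m < N" for x m
  proof (rule differentiableI_vector, rule has_vector_derivative_cong_region[OF Suc.prems(1) that])
    show "((\<lambda>s. f (x(m := s))) has_vector_derivative pdiff m f x) (at (x m))"
      using Suc.prems(2) that by (intro has_pdiff) auto
  qed
  moreover have "Ck r N \<Omega> (pdiff m g)" if "m < N" for m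
    using Suc.IH[of "pdiff m f" "pdiff m g"] Suc.prems that pdiff_cong[of f g] by simp
  moreover have "continuous_on \<Omega> g"
    using continuous_on_cong[of \<Omega> \<Omega> f g] Suc.prems by simp
  ultimately show ?case by simp
qed

lemma smooth_fun_cong:
  assumes "\<And>y. y \<in> \<Omega> \<Longrightarrow> f y = g y" "smooth_fun N \<Omega> f"
  shows "smooth_fun N \<Omega> g"
  using assms Ck_cong unfolding smooth_fun_iff_Ck by blast

lemma Ck_add: "Ck r N \<Omega> f \<Longrightarrow> Ck r N \<Omega> g \<Longrightarrow> Ck r N \<Omega> (\<lambda>x. f x + g x)"
proof (induction r arbitrary: f g)
  case 0
  then show ?case by (simp add: continuous_on_add)
next
  case (Suc r)
  have "Ck r N \<Omega> (pdiff m (\<lambda>x. f x + g x))" if "m < N" for m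
    by (rule Ck_cong[of "\<lambda>x. pdiff m f x + pdiff m g x"])
      (use Suc that in \<open>auto simp: pdiff_add\<close>)
  then show ?case
    using Suc.prems by (auto intro: continuous_on_add)
qed

lemma Ck_mult: "Ck r N \<Omega> f \<Longrightarrow> Ck r N \<Omega> g \<Longrightarrow> Ck r N \<Omega> (\<lambda>x. f x * g x)"
proof (induction r arbitrary: f g)
  case 0
  then show ?case by (simp add: continuous_on_mult)
next
  case (Suc r)
  have "Ck r N \<Omega> (pdiff m (\<lambda>x. f x * g x))" if "m < N" for m
  proof (rule Ck_cong)
    show "Ck r N \<Omega> (\<lambda>x. pdiff m f x * g x + f x * pdiff m g x)"
      using Suc.prems that Ck_mono by (intro Ck_add Suc.IH) auto
  qed (use Suc.prems that in \<open>auto simp: pdiff_mult\<close>)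
  then show ?case
    using Suc.prems by (auto intro: continuous_on_mult)
qed

lemma Ck_inverse:
  assumes nz: "\<And>x. x \<in> \<Omega> \<Longrightarrow> f x \<noteq> 0"
  shows "Ck r N \<Omega> f \<Longrightarrow> Ck r N \<Omega> (\<lambda>x. inverse (f x))"
proof (induction r)
  case 0
  then show ?case using nz by (simp add: continuous_on_inverse)
next
  case (Suc r)
  have "Ck r N \<Omega> (pdiff m (\<lambda>x. inverse (f x)))" if "m < N" for m
  proof (rule Ck_cong)
    \<comment> \<open>Here f stays fixed in the induction: the derivative of the inverse is built
      from that of f and two copies of the inverse itself, which has order r by the induction
      hypothesis.\<close>
    show "Ck r N \<Omega> (\<lambda>x. - 1 * (pdiff m f x * inverse (f x) * inverse (f x)))"
      using Suc that Ck_mono[of r] by (intro Ck_mult) auto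
  next
    fix y assume "y \<in> \<Omega>"
    then have "pdiff m (\<lambda>x. inverse (f x)) y = - (pdiff m f y * inverse (f y) * inverse (f y))"
      using Suc.prems that nz by (intro pdiff_eqI pdiff_inverse) auto
    then show "- 1 * (pdiff m f y * inverse (f y) * inverse (f y)) = pdiff m (\<lambda>x. inverse (f x)) y"
      by simp
  qed
  moreover have "(\<lambda>s. inverse (f (x(m := s)))) differentiable (at (x m))" if "x \<in> \<Omega>" "m < N" for x m
    using pdiff_inverse[of f x m] Suc.prems that nz by (auto intro: differentiableI_vector)
  ultimately show ?case
    using Suc.prems nz by (auto intro: continuous_on_inverse)
qed

lemma smooth_fun_add [intro]:
  "smooth_fun N \<Omega> f \<Longrightarrow> smooth_fun N \<Omega> g \<Longrightarrow> smooth_fun N \<Omega> (\<lambda>x. f x + g x)"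
  by (simp add: smooth_fun_iff_Ck Ck_add)

lemma smooth_fun_mult [intro]:
  "smooth_fun N \<Omega> f \<Longrightarrow> smooth_fun N \<Omega> g \<Longrightarrow> smooth_fun N \<Omega> (\<lambda>x. f x * g x)"
  by (simp add: smooth_fun_iff_Ck Ck_mult)

lemma smooth_fun_inverse [intro]:
  "smooth_fun N \<Omega> f \<Longrightarrow> (\<And>x. x \<in> \<Omega> \<Longrightarrow> f x \<noteq> 0) \<Longrightarrow> smooth_fun N \<Omega> (\<lambda>x. inverse (f x))"
  by (simp add: smooth_fun_iff_Ck Ck_inverse)

lemma smooth_fun_minus [intro]: "smooth_fun N \<Omega> f \<Longrightarrow> smooth_fun N \<Omega> (\<lambda>x. - f x)"
  using smooth_fun_mult[of "\<lambda>_. - 1" f] by simp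

lemma smooth_fun_diff [intro]:
  "smooth_fun N \<Omega> f \<Longrightarrow> smooth_fun N \<Omega> g \<Longrightarrow> smooth_fun N \<Omega> (\<lambda>x. f x - g x)"
  using smooth_fun_add[of f "\<lambda>x. - g x"] by auto

lemma smooth_fun_sum [intro]:
  "(\<And>i. i \<in> A \<Longrightarrow> smooth_fun N \<Omega> (f i)) \<Longrightarrow> smooth_fun N \<Omega> (\<lambda>x. \<Sum>i\<in>A. f i x)"
  by (induction A rule: infinite_finite_induct) (auto simp: smooth_fun_add)

end

section \<open>Symmetry of mixed partial derivatives\<close>

lemma mixed_difference_MVT:
  fixes g A :: "real \<Rightarrow> real \<Rightarrow> real"
  assumes h: "h > 0"
    and gs: "\<And>s t. s \<in> {a..a+h} \<Longrightarrow> t \<in> {b..b+h} \<Longrightarrow> ((\<lambda>r. g r t) has_real_derivative gs s t) (at s)"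
    and A: "\<And>s t. s \<in> {a..a+h} \<Longrightarrow> t \<in> {b..b+h} \<Longrightarrow> ((\<lambda>r. gs s r) has_real_derivative A s t) (at t)"
  obtains s t where "s \<in> {a..a+h}" "t \<in> {b..b+h}"
    "g (a+h) (b+h) - g (a+h) b - g a (b+h) + g a b = h * h * A s t"
proof -
  obtain s where s: "s > a" "s < a + h" and
    *: "(g (a+h) (b+h) - g (a+h) b) - (g a (b+h) - g a b) = (a + h - a) * (gs s (b+h) - gs s b)"
    using MVT2[of a "a+h" "\<lambda>r. g r (b+h) - g r b" "\<lambda>r. gs r (b+h) - gs r b"] h gs
    by (force intro!: derivative_intros)
  obtain t where t: "t > b" "t < b + h" and **: "gs s (b+h) - gs s b = (b + h - b) * A s t"
    using MVT2[of b "b+h" "gs s" "A s"] h A[of s] s by force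
  show ?thesis
    using that[of s t] s t * ** by (simp add: algebra_simps)
qed

text \<open>The second difference of g over a square of side h is the same in either order of the
  variables. Mean values turn it into h * h times \<open>A\<close> at one point of the square and h
  * h times \<open>B\<close> at another; for small h continuity puts both values near those at the
  corner.\<close>

lemma mixed_derivatives_commute_real:
  fixes g A B :: "real \<Rightarrow> real \<Rightarrow> real"
  assumes e: "e > 0"
    and gs: "\<And>s t. \<bar>s - a\<bar> < e \<Longrightarrow> \<bar>t - b\<bar> < e \<Longrightarrow> ((\<lambda>r. g r t) has_real_derivative gs s t) (at s)"
    and A: "\<And>s t. \<bar>s - a\<bar> < e \<Longrightarrow> \<bar>t - b\<bar> < e \<Longrightarrow> ((\<lambda>r. gs s r) has_real_derivative A s t) (at t)"
    and gt: "\<And>s t. \<bar>s - a\<bar> < e \<Longrightarrow> \<bar>t - b\<bar> < e \<Longrightarrow> ((\<lambda>r. g s r) has_real_derivative gt s t) (at t)"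
    and B: "\<And>s t. \<bar>s - a\<bar> < e \<Longrightarrow> \<bar>t - b\<bar> < e \<Longrightarrow> ((\<lambda>r. gt r t) has_real_derivative B s t) (at s)"
    and contA: "isCont (\<lambda>p. A (fst p) (snd p)) (a, b)"
    and contB: "isCont (\<lambda>p. B (fst p) (snd p)) (a, b)"
  shows "A a b = B a b"
proof (rule ccontr)
  assume ne: "A a b \<noteq> B a b"
  define \<epsilon> where "\<epsilon> = dist (A a b) (B a b) / 2"
  have \<epsilon>: "\<epsilon> > 0" using ne by (simp add: \<epsilon>_def)
  obtain d1 where d1: "d1 > 0" "\<And>p. dist p (a, b) < d1 \<Longrightarrow> dist (A (fst p) (snd p)) (A a b) < \<epsilon>"
    using contA \<epsilon> unfolding continuous_at_eps_delta by fastforce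
  obtain d2 where d2: "d2 > 0" "\<And>p. dist p (a, b) < d2 \<Longrightarrow> dist (B (fst p) (snd p)) (B a b) < \<epsilon>"
    using contB \<epsilon> unfolding continuous_at_eps_delta by fastforce
  \<comment> \<open>With this h the square stays within e of the corner, and the distance of its
    points from (a, b), at most 2 * h, is below d1 and d2.\<close>
  define h where "h = min e (min d1 d2) / 3"
  have h: "h > 0" "h < e" "2 * h < d1" "2 * h < d2" using e d1 d2 by (auto simp: h_def min_def)
  have near: "\<bar>s - a\<bar> < e" if "s \<in> {a..a+h}" for a s using that h by auto
  have dst: "dist (s, t) (a, b) \<le> 2 * h" if "s \<in> {a..a+h}" "t \<in> {b..b+h}" for s t
  proof -
    have "dist (s, t) (a, b) \<le> \<bar>s - a\<bar> + \<bar>t - b\<bar>"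
      unfolding dist_Pair_Pair dist_real_def
      by (metis abs_ge_zero power2_abs sqrt_sum_squares_le_sum)
    then show ?thesis using that by auto
  qed
  obtain s t where st: "s \<in> {a..a+h}" "t \<in> {b..b+h}"
    "g (a+h) (b+h) - g (a+h) b - g a (b+h) + g a b = h * h * A s t"
    using mixed_difference_MVT[OF h(1), of a b g gs A] gs A near by metis
  obtain t' s' where st': "t' \<in> {b..b+h}" "s' \<in> {a..a+h}"
    "g (a+h) (b+h) - g a (b+h) - g (a+h) b + g a b = h * h * B s' t'"
    using mixed_difference_MVT[OF h(1), of b a "\<lambda>t s. g s t" "\<lambda>t s. gt s t" "\<lambda>t s. B s t"] gt B near
    by metis
  have "A s t = B s' t'" using st(3) st'(3) h(1) by (simp add: algebra_simps)
  moreover have "dist (A s t) (A a b) < \<epsilon>" using d1(2)[of "(s, t)"] dst[OF st(1,2)] h by simp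
  moreover have "dist (B s' t') (B a b) < \<epsilon>" using d2(2)[of "(s', t')"] dst[OF st'(2,1)] h by simp
  ultimately show False
    using dist_triangle_half_r[of "A s t" "A a b" "dist (A a b) (B a b)" "B a b"] by (simp add: \<epsilon>_def)
qed

context region
begin

lemma pdiff_commute:
  assumes f: "smooth_fun N \<Omega> f" and x: "x \<in> \<Omega>" and ml: "m < N" "l < N"
  shows "pdiff m (pdiff l f) x = pdiff l (pdiff m f) x"
proof (cases "m = l")
  case False
  obtain e where e: "e > 0"
    and box: "\<And>s t. \<bar>s - x m\<bar> < e \<Longrightarrow> \<bar>t - x l\<bar> < e \<Longrightarrow> x(m := s, l := t) \<in> \<Omega>"
    using box_in_region[OF x ml] by metis
  define y where "y s t = x(m := s, l := t)" for s t
  have y: "y s t m = s" "y s t l = t" "(y s t)(m := r) = y r t" "(y s t)(l := r) = y s r" for s t r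
    using False by (auto simp: y_def fun_eq_iff)
  have dm: "((\<lambda>r. g (y r t)) has_vector_derivative pdiff m g (y s t)) (at s)"
    and dl: "((\<lambda>r. g (y s r)) has_vector_derivative pdiff l g (y s t)) (at t)"
    if "smooth_fun N \<Omega> g" "\<bar>s - x m\<bar> < e" "\<bar>t - x l\<bar> < e" for g s t
    using has_pdiff[OF smooth_fun_differentiable[OF that(1) ml(1) box[OF that(2,3)]]]
      has_pdiff[OF smooth_fun_differentiable[OF that(1) ml(2) box[OF that(2,3)]]]
    unfolding y_def[symmetric] y by auto
  \<comment> \<open>Continuity relative to \<Omega> is pulled back to the plane of the two moving
    coordinates, where the rectangle is open.\<close>
  have cont: "isCont (\<lambda>p. g (y (fst p) (snd p))) (x m, x l)" if "smooth_fun N \<Omega> g" for g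
  proof -
    let ?U = "{x m - e<..<x m + e} \<times> {x l - e<..<x l + e}"
    have "continuous_on ?U (\<lambda>p. y (fst p) (snd p))" unfolding y_def
      by (rule continuous_on_coordinatewise_then_product, rename_tac i, case_tac "i = l"; case_tac "i = m")
        (auto intro!: continuous_intros)
    moreover have "(\<lambda>p. y (fst p) (snd p)) ` ?U \<subseteq> \<Omega>"
      using box unfolding y_def by (auto simp: abs_less_iff)
    ultimately have "continuous_on ?U (\<lambda>p. g (y (fst p) (snd p)))"
      using smooth_fun_continuous[OF that] continuous_on_compose2 by blast
    moreover have "open ?U" by (intro open_Times) auto
    moreover have "(x m, x l) \<in> ?U" using e by simp
    ultimately show ?thesis
      using continuous_on_eq_continuous_at[of ?U] by blast
  qed
  have x_eq: "y (x m) (x l) = x" by (simp add: y_def)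
  \<comment> \<open>The mean value theorem fails for complex values, hence the detour through real
    functionals; \<open>Re\<close> and \<open>Im\<close> together determine the number.\<close>
  have lin: "\<phi> (pdiff l (pdiff m f) x) = \<phi> (pdiff m (pdiff l f) x)"
    if "bounded_linear \<phi>" for \<phi> :: "complex \<Rightarrow> real"
  proof -
    have D: "((\<lambda>r. \<phi> (G r)) has_real_derivative \<phi> c) (at r)"
      if "(G has_vector_derivative c) (at r)" for G c r
      using bounded_linear.has_vector_derivative[OF \<open>bounded_linear \<phi>\<close> that]
      by (simp add: has_real_derivative_iff_has_vector_derivative)
    have C: "isCont (\<lambda>p. \<phi> (g (y (fst p) (snd p)))) (x m, x l)" if "smooth_fun N \<Omega> g" for g
      using bounded_linear.isCont[OF \<open>bounded_linear \<phi>\<close> cont[OF that]] .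
    have "\<phi> (pdiff l (pdiff m f) (y (x m) (x l))) = \<phi> (pdiff m (pdiff l f) (y (x m) (x l)))"
      by (rule mixed_derivatives_commute_real[where g = "\<lambda>s t. \<phi> (f (y s t))"
            and gs = "\<lambda>s t. \<phi> (pdiff m f (y s t))" and gt = "\<lambda>s t. \<phi> (pdiff l f (y s t))", OF e])
        (auto intro!: D dm dl C smooth_fun_pdiff f ml)
    then show ?thesis by (simp add: x_eq)
  qed
  show ?thesis
    using lin[OF bounded_linear_Re] lin[OF bounded_linear_Im] by (simp add: complex_eq_iff)
qed simp

end

section \<open>The operators \<open>d\<^sup>A\<^sup>'\<close>\<close>

text \<open>The sign in \<omega>^A \<and> \<omega>^(K - {A}) = \<plusminus> \<omega>^K: the new
  factor has to pass the elements of K below A.\<close>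

definition ext_sign :: "nat \<Rightarrow> nat set \<Rightarrow> complex" where
  "ext_sign A K = (-1) ^ card {q \<in> K. q < A}"

lemma wedge_basis_form:
  "wedge (basis_form {A}) (basis_form I) K =
     (if finite K \<and> A \<in> K \<and> I = K - {A} then ext_sign A K else 0)"
proof (cases "finite K")
  case True
  let ?s = "\<lambda>J. (-1) ^ card {(p, q). p \<in> J \<and> q \<in> K - J \<and> q < p} :: complex"
  have "{(p, q). p \<in> {A} \<and> q \<in> K - {A} \<and> q < p} = Pair A ` {q \<in> K. q < A}" by auto
  then have s: "?s {A} = ext_sign A K"
    unfolding ext_sign_def by (simp add: card_image inj_on_def)
  have "wedge (basis_form {A}) (basis_form I) K =
      (\<Sum>J\<in>Pow K. if J = {A} then ext_sign A K * basis_form I (K - {A}) else 0)"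
    unfolding wedge_def s[symmetric] by (rule sum.cong) (auto simp: basis_form_def)
  also have "\<dots> = (if A \<in> K then ext_sign A K * basis_form I (K - {A}) else 0)"
    using True by (simp add: sum.delta)
  finally show ?thesis
    using True by (auto simp: basis_form_def)
\<comment> \<open>For infinite K the sum over \<open>Pow K\<close> is 0 by convention.\<close>
qed (simp add: wedge_def)

text \<open>A pair A, I contributes to the coefficient at K only if I is K without A, so the double
  sum collapses. The later computations start from this form.\<close>

lemma d_op_eq:
  "d_op n P f x K =
     (if K \<subseteq> {..<2 * n} then \<Sum>A\<in>K. ext_sign A K * nabla A P (\<lambda>y. f y (K - {A})) x else 0)"
proof -
  have "d_op n P f x K = (\<Sum>A<2 * n. \<Sum>I\<in>Pow {..<2 * n}.
      if I = K - {A} then (if finite K \<and> A \<in> K then nabla A P (\<lambda>y. f y (K - {A})) x * ext_sign A K else 0) else 0)"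
    unfolding d_op_def wedge_basis_form by (intro sum.cong refl) simp
  also have "\<dots> = (\<Sum>A<2 * n. if finite K \<and> A \<in> K \<and> K - {A} \<subseteq> {..<2 * n}
      then nabla A P (\<lambda>y. f y (K - {A})) x * ext_sign A K else 0)"
    by (intro sum.cong refl) (simp add: sum.delta)
  also have "\<dots> = (\<Sum>A<2 * n. if K \<subseteq> {..<2 * n} \<and> A \<in> K
      then ext_sign A K * nabla A P (\<lambda>y. f y (K - {A})) x else 0)"
    by (intro sum.cong refl if_cong) (auto simp: finite_subset)
  also have "\<dots> = (if K \<subseteq> {..<2 * n} then \<Sum>A\<in>K. ext_sign A K * nabla A P (\<lambda>y. f y (K - {A})) x else 0)"
  proof (cases "K \<subseteq> {..<2 * n}")
    case True
    then show ?thesis by (simp add: sum.If_cases Int_absorb1)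
  qed simp
  finally show ?thesis .
qed

lemma ext_sign_Diff:
  assumes "finite K" "A \<in> K"
  shows "ext_sign B (K - {A}) = (if A < B then - ext_sign B K else ext_sign B K)"
proof (cases "A < B")
  case True
  have "{q \<in> K. q < B} = insert A {q \<in> K - {A}. q < B}" using True assms(2) by auto
  then have "card {q \<in> K. q < B} = Suc (card {q \<in> K - {A}. q < B})"
    using assms(1) by simp
  then show ?thesis using True by (simp add: ext_sign_def)
next
  case False
  then have "{q \<in> K - {A}. q < B} = {q \<in> K. q < B}" by auto
  then show ?thesis using False by (simp add: ext_sign_def)
qed

text \<open>Exactly one of A < B and B < A holds, so exactly one of the two removals flips a sign.
  This sign makes the operators \<open>d_op\<close> anticommute.\<close>

lemma ext_sign_swap:
  assumes "finite K" "A \<in> K" "B \<in> K" "A \<noteq> B"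
  shows "ext_sign A K * ext_sign B (K - {A}) = - (ext_sign B K * ext_sign A (K - {B}))"
  using assms by (auto simp: ext_sign_Diff)

text \<open>The one-form d^P z wedged with f, that is, the correction term in the Leibniz rule
  \<open>d_op_mult\<close>.\<close>

definition wedge_d :: "nat \<Rightarrow> primed \<Rightarrow> (point \<Rightarrow> complex) \<Rightarrow> (point \<Rightarrow> ext) \<Rightarrow> point \<Rightarrow> ext" where
  "wedge_d n P z f x K =
     (if K \<subseteq> {..<2 * n} then \<Sum>A\<in>K. ext_sign A K * nabla A P z x * f x (K - {A}) else 0)"

lemma pdiff_linear_coord:
  "pdiff m (\<lambda>x. a * complex_of_real (x p) + b * complex_of_real (x q)) =
     (\<lambda>x. a * (if p = m then 1 else 0) + b * (if q = m then 1 else 0))"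
proof (rule ext, rule pdiff_eqI)
  fix x :: point
  have "((\<lambda>s. complex_of_real ((x(m := s)) i)) has_vector_derivative (if i = m then 1 else 0)) (at (x m))" for i
    using has_pdiff[OF differentiable_coord[of x m i]] by simp
  from has_vector_derivative_add[OF has_vector_derivative_mult_right[OF this] has_vector_derivative_mult_right[OF this]]
  show "((\<lambda>s. a * complex_of_real ((x(m := s)) p) + b * complex_of_real ((x(m := s)) q))
      has_vector_derivative a * (if p = m then 1 else 0) + b * (if q = m then 1 else 0)) (at (x m))" .
qed

lemma z_coord_linear:
  "z_coord A P = (\<lambda>x.
     (if P = P0 \<and> A \<noteq> 0 then - 1 else 1) * complex_of_real (x (if (P = P0) = (A = 0) then 2 else 0)) +
     (if P = P1 \<and> A \<noteq> 0 then - \<i> else \<i>) * complex_of_real (x (if (P = P0) = (A = 0) then 3 else 1)))"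
  by (cases P) (auto simp: z_coord_def fun_eq_iff)

text \<open>Only the block t = 0 sees the coordinates on which z depends. For A, B in {0, 1} the
  table of values is -2 times the product of the antisymmetric symbol in (A, B) and that in the
  primed indices, each normalised to 1 at (0, 1).\<close>

lemma nabla_z_coord:
  "nabla A P (z_coord B P) x = 0"
  "nabla A P0 (z_coord B P1) x = - nabla A P1 (z_coord B P0) x"
proof -
  have *: "pdiff m (z_coord B P) x = 0" if "m > 3" for m P B
    using that unfolding z_coord_linear pdiff_linear_coord by simp
  have **: "pdiff m (z_coord B P) x =
      (if P = P0 \<and> B \<noteq> 0 then - 1 else 1) * (if (if (P = P0) = (B = 0) then 2 else 0) = m then 1 else 0) +
      (if P = P1 \<and> B \<noteq> 0 then - \<i> else \<i>) * (if (if (P = P0) = (B = 0) then 3 else 1) = m then 1 else 0)" for m P B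
    unfolding z_coord_linear pdiff_linear_coord by simp
  obtain t where t: "A div 2 = t" by blast
  show "nabla A P (z_coord B P) x = 0"
    unfolding nabla_def Let_def t
    by (cases "t = 0"; cases "even A"; cases P; cases "B = 0") (simp_all add: * **)
  show "nabla A P0 (z_coord B P1) x = - nabla A P1 (z_coord B P0) x"
    unfolding nabla_def Let_def t
    by (cases "t = 0"; cases "even A"; cases "B = 0") (simp_all add: * **)
qed

lemma wedge_d_z_coord:
  "wedge_d n P (z_coord B P) f x K = 0"
  "wedge_d n P0 (z_coord B P1) f x K = - wedge_d n P1 (z_coord B P0) f x K"
  by (simp_all add: wedge_d_def nabla_z_coord sum_negf)

definition zdet :: "point \<Rightarrow> complex" where
  "zdet x = z_coord 0 P0 x * z_coord 1 P1 x - z_coord 1 P0 x * z_coord 0 P1 x"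

lemma zdet_eq: "zdet x = of_real ((x 0)\<^sup>2 + (x 1)\<^sup>2 + (x 2)\<^sup>2 + (x 3)\<^sup>2)"
  by (simp add: zdet_def z_coord_def complex_eq_iff power2_eq_square algebra_simps)

text \<open>Contraction of the first primed index with row B of the matrix z. Both
  \<open>L_map\<close> and \<open>Lt_map\<close> are assembled from it (\<open>L_map_contr\<close>,
  \<open>Lt_map_contr\<close>), so commutation rules are proved once, here.\<close>

definition contr :: "nat \<Rightarrow> (point \<Rightarrow> symext) \<Rightarrow> point \<Rightarrow> symext" where
  "contr B h x As I = z_coord B P0 x * h x (P0 # As) I + z_coord B P1 x * h x (P1 # As) I"

definition dd :: "nat \<Rightarrow> (point \<Rightarrow> symext) \<Rightarrow> point \<Rightarrow> symext" where
  "dd n h x As K = d_op n P0 (\<lambda>y. h y (P0 # As)) x K + d_op n P1 (\<lambda>y. h y (P1 # As)) x K"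

section \<open>First-order calculus on a region of H^n\<close>

locale quat_region = region "4 * n" \<Omega> for n \<Omega>
begin

abbreviation smooth :: "(point \<Rightarrow> complex) \<Rightarrow> bool" where
  "smooth \<equiv> smooth_fun (4 * n) \<Omega>"

definition esmooth :: "(point \<Rightarrow> ext) \<Rightarrow> bool" where
  "esmooth f \<longleftrightarrow> (\<forall>I. smooth (\<lambda>x. f x I))"

lemma esmoothD: "esmooth f \<Longrightarrow> smooth (\<lambda>x. f x I)"
  by (simp add: esmooth_def)

text \<open>From this common shape the sum, product and commutation rules follow without splitting
  into the four cases; A < 2 * n keeps both coordinates below 4 * n.\<close>

lemma nabla_form:
  assumes "A < 2 * n"
  obtains a b m l where "m < 4 * n" "l < 4 * n"
    "nabla A P = (\<lambda>f x. a * pdiff m f x + b * pdiff l f x)"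
proof -
  have "A div 2 < n" using assms by (simp add: less_mult_imp_div_less)
  then have t: "4 * (A div 2) + 3 < 4 * n" by linarith
  show ?thesis
  proof (cases "P = P0")
    case True
    show ?thesis
    proof (cases "even A")
      case True
      then show ?thesis using t \<open>P = P0\<close>
        by (intro that[of "4 * (A div 2) + 2" "4 * (A div 2) + 3" "- 1" "- \<i>"])
          (auto simp: nabla_def fun_eq_iff Let_def)
    next
      case False
      then show ?thesis using t \<open>P = P0\<close>
        by (intro that[of "4 * (A div 2)" "4 * (A div 2) + 1" 1 "- \<i>"])
          (auto simp: nabla_def fun_eq_iff Let_def)
    qed
  next
    case False
    then have P: "P = P1" by (cases P) auto
    show ?thesis
    proof (cases "even A")
      case True
      then show ?thesis using t P
        by (intro that[of "4 * (A div 2)" "4 * (A div 2) + 1" "- 1" "- \<i>"])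
          (auto simp: nabla_def fun_eq_iff Let_def)
    next
      case False
      then show ?thesis using t P
        by (intro that[of "4 * (A div 2) + 2" "4 * (A div 2) + 3" "- 1" "\<i>"])
          (auto simp: nabla_def fun_eq_iff Let_def)
    qed
  qed
qed

lemma nabla_cong:
  assumes "A < 2 * n" "\<And>y. y \<in> \<Omega> \<Longrightarrow> f y = g y" "x \<in> \<Omega>"
  shows "nabla A P f x = nabla A P g x"
proof -
  obtain a b m l where "m < 4 * n" "l < 4 * n" "nabla A P = (\<lambda>f x. a * pdiff m f x + b * pdiff l f x)"
    using nabla_form[OF assms(1)] .
  then show ?thesis using pdiff_cong[of f g x] assms(2,3) by simp
qed

lemma smooth_nabla:
  assumes "A < 2 * n" "smooth f"
  shows "smooth (nabla A P f)"
proof -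
  obtain a b m l where "m < 4 * n" "l < 4 * n" "nabla A P = (\<lambda>f x. a * pdiff m f x + b * pdiff l f x)"
    using nabla_form[OF assms(1)] .
  then show ?thesis using assms(2) by (simp add: smooth_fun_add smooth_fun_mult smooth_fun_pdiff)
qed

lemma nabla_add:
  assumes "A < 2 * n" "smooth f" "smooth g" "x \<in> \<Omega>"
  shows "nabla A P (\<lambda>y. f y + g y) x = nabla A P f x + nabla A P g x"
proof -
  obtain a b m l where "m < 4 * n" "l < 4 * n" "nabla A P = (\<lambda>f x. a * pdiff m f x + b * pdiff l f x)"
    using nabla_form[OF assms(1)] .
  then show ?thesis
    using assms by (simp add: pdiff_add smooth_fun_differentiable algebra_simps)
qed

lemma nabla_mult:
  assumes "A < 2 * n" "smooth f" "smooth g" "x \<in> \<Omega>"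
  shows "nabla A P (\<lambda>y. f y * g y) x = nabla A P f x * g x + f x * nabla A P g x"
proof -
  obtain a b m l where "m < 4 * n" "l < 4 * n" "nabla A P = (\<lambda>f x. a * pdiff m f x + b * pdiff l f x)"
    using nabla_form[OF assms(1)] .
  then show ?thesis
    using assms by (simp add: pdiff_mult smooth_fun_differentiable algebra_simps)
qed

lemma nabla_const: "A < 2 * n \<Longrightarrow> nabla A P (\<lambda>y. c) x = 0"
  by (rule nabla_form[of A P]) simp_all

lemma nabla_scale:
  "A < 2 * n \<Longrightarrow> smooth f \<Longrightarrow> x \<in> \<Omega> \<Longrightarrow> nabla A P (\<lambda>y. c * f y) x = c * nabla A P f x"
  by (simp add: nabla_mult nabla_const)

lemma nabla_sum:
  assumes "A < 2 * n" "x \<in> \<Omega>" "\<And>i. i \<in> S \<Longrightarrow> smooth (f i)"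
  shows "nabla A P (\<lambda>y. \<Sum>i\<in>S. f i y) x = (\<Sum>i\<in>S. nabla A P (f i) x)"
  using assms(3)
proof (induction S rule: infinite_finite_induct)
  case (insert i S)
  then show ?case using assms(1,2) by (simp add: nabla_add smooth_fun_sum)
qed (simp_all add: nabla_const assms(1))

lemma nabla_commute:
  assumes "A < 2 * n" "B < 2 * n" "smooth f" "x \<in> \<Omega>"
  shows "nabla A P (nabla B Q f) x = nabla B Q (nabla A P f) x"
proof -
  obtain a b m l where 1: "m < 4 * n" "l < 4 * n" "nabla A P = (\<lambda>f x. a * pdiff m f x + b * pdiff l f x)"
    using nabla_form[OF assms(1)] .
  obtain a' b' m' l' where 2: "m' < 4 * n" "l' < 4 * n" "nabla B Q = (\<lambda>f x. a' * pdiff m' f x + b' * pdiff l' f x)"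
    using nabla_form[OF assms(2)] .
  have S: "smooth (pdiff r f)" if "r < 4 * n" for r using that assms(3) smooth_fun_pdiff by blast
  have "nabla A P (nabla B Q f) x = a' * nabla A P (pdiff m' f) x + b' * nabla A P (pdiff l' f) x"
    unfolding 2(3) using assms(1,4) 2 S by (simp add: nabla_add nabla_scale smooth_fun_mult)
  also have "\<dots> = a * nabla B Q (pdiff m f) x + b * nabla B Q (pdiff l f) x"
    unfolding 2(3) 1(3) using 1 2 assms(3,4) by (simp add: pdiff_commute[of f x] algebra_simps)
  also have "\<dots> = nabla B Q (nabla A P f) x"
    unfolding 1(3) using assms(2,4) 1 S by (simp add: nabla_add nabla_scale smooth_fun_mult)
  finally show ?thesis .
qed

lemma d_op_cong:
  assumes "\<And>y I. y \<in> \<Omega> \<Longrightarrow> f y I = g y I" "x \<in> \<Omega>"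
  shows "d_op n P f x K = d_op n P g x K"
  unfolding d_op_eq
proof (rule if_cong[OF refl _ refl], rule sum.cong[OF refl])
  fix A assume "K \<subseteq> {..<2 * n}" "A \<in> K"
  then have "A < 2 * n" by auto
  then show "ext_sign A K * nabla A P (\<lambda>y. f y (K - {A})) x = ext_sign A K * nabla A P (\<lambda>y. g y (K - {A})) x"
    using nabla_cong[of A "\<lambda>y. f y (K - {A})" "\<lambda>y. g y (K - {A})" x P] assms by simp
qed

lemma esmooth_d_op: "esmooth f \<Longrightarrow> esmooth (d_op n P f)"
  unfolding esmooth_def d_op_eq
proof (intro allI)
  fix K assume f: "\<forall>I. smooth (\<lambda>x. f x I)"
  show "smooth (\<lambda>x. if K \<subseteq> {..<2 * n} then \<Sum>A\<in>K. ext_sign A K * nabla A P (\<lambda>y. f y (K - {A})) x else 0)"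
    using f by (cases "K \<subseteq> {..<2 * n}") (auto intro!: smooth_fun_sum smooth_fun_mult smooth_nabla)
qed

lemma esmooth_add: "esmooth f \<Longrightarrow> esmooth g \<Longrightarrow> esmooth (\<lambda>y I. f y I + g y I)"
  by (simp add: esmooth_def smooth_fun_add)

lemma esmooth_mult: "smooth z \<Longrightarrow> esmooth f \<Longrightarrow> esmooth (\<lambda>y I. z y * f y I)"
  by (simp add: esmooth_def smooth_fun_mult)

lemma esmooth_wedge_d: "smooth z \<Longrightarrow> esmooth f \<Longrightarrow> esmooth (wedge_d n P z f)"
  unfolding esmooth_def wedge_d_def
proof (intro allI)
  fix K assume f: "smooth z" "\<forall>I. smooth (\<lambda>x. f x I)"
  show "smooth (\<lambda>x. if K \<subseteq> {..<2 * n} then \<Sum>A\<in>K. ext_sign A K * nabla A P z x * f x (K - {A}) else 0)"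
    using f by (cases "K \<subseteq> {..<2 * n}") (auto intro!: smooth_fun_sum smooth_fun_mult smooth_nabla)
qed

lemma d_op_add:
  assumes "esmooth f" "esmooth g" "x \<in> \<Omega>"
  shows "d_op n P (\<lambda>y I. f y I + g y I) x K = d_op n P f x K + d_op n P g x K"
proof (cases "K \<subseteq> {..<2 * n}")
  case True
  have "nabla A P (\<lambda>y. f y (K - {A}) + g y (K - {A})) x =
      nabla A P (\<lambda>y. f y (K - {A})) x + nabla A P (\<lambda>y. g y (K - {A})) x" if "A \<in> K" for A
    using True that assms by (intro nabla_add esmoothD) auto
  then show ?thesis
    using True by (simp add: d_op_eq distrib_left sum.distrib)
qed (simp add: d_op_eq)

lemma d_op_mult:
  assumes "smooth z" "esmooth f" "x \<in> \<Omega>"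
  shows "d_op n P (\<lambda>y I. z y * f y I) x K = z x * d_op n P f x K + wedge_d n P z f x K"
proof (cases "K \<subseteq> {..<2 * n}")
  case True
  have "nabla A P (\<lambda>y. z y * f y (K - {A})) x =
      nabla A P z x * f x (K - {A}) + z x * nabla A P (\<lambda>y. f y (K - {A})) x" if "A \<in> K" for A
    using True that nabla_mult[OF _ assms(1) esmoothD[OF assms(2)] assms(3)] by auto
  then show ?thesis
    using True by (simp add: d_op_eq wedge_d_def distrib_left sum.distrib sum_distrib_left mult_ac)
qed (simp add: d_op_eq wedge_d_def)

lemma d_op_anticommute:
  assumes f: "esmooth f" and x: "x \<in> \<Omega>"
  shows "d_op n P (d_op n Q f) x K = - d_op n Q (d_op n P f) x K"
proof (cases "K \<subseteq> {..<2 * n}")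
  case True
  then have fin: "finite K" and lt: "A \<in> K \<Longrightarrow> A < 2 * n" for A
    by (auto intro: finite_subset)
  \<comment> \<open>Zero on the diagonal lets both indices range over K, so that the summations can
    be exchanged. Off the diagonal, \<open>ext_sign_swap\<close> and commuting derivatives give the
    antisymmetry.\<close>
  define T where "T P Q A B = (if A = B then 0 else ext_sign A K * ext_sign B (K - {A}) *
      nabla A P (nabla B Q (\<lambda>y. f y (K - {A} - {B}))) x)" for P Q A B
  have E: "d_op n P (d_op n Q f) x K = (\<Sum>A\<in>K. \<Sum>B\<in>K. T P Q A B)" for P Q
  proof -
    have "ext_sign A K * nabla A P (\<lambda>y. d_op n Q f y (K - {A})) x = (\<Sum>B\<in>K. T P Q A B)" if A: "A \<in> K" for A
    proof -
      have sub: "K - {A} \<subseteq> {..<2 * n}" using True by auto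
      have "nabla A P (\<lambda>y. d_op n Q f y (K - {A})) x =
          (\<Sum>B\<in>K - {A}. ext_sign B (K - {A}) * nabla A P (nabla B Q (\<lambda>y. f y (K - {A} - {B}))) x)"
      proof -
        have S: "smooth (nabla B Q (\<lambda>y. f y (K - {A} - {B})))" if "B \<in> K - {A}" for B
          using that f lt by (auto intro: smooth_nabla esmoothD)
        have "nabla A P (\<lambda>y. d_op n Q f y (K - {A})) x =
            nabla A P (\<lambda>y. \<Sum>B\<in>K - {A}. ext_sign B (K - {A}) * nabla B Q (\<lambda>y. f y (K - {A} - {B})) y) x"
          using sub by (simp add: d_op_eq)
        also have "\<dots> = (\<Sum>B\<in>K - {A}. nabla A P (\<lambda>y. ext_sign B (K - {A}) * nabla B Q (\<lambda>y. f y (K - {A} - {B})) y) x)"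
          using lt[OF A] x S by (intro nabla_sum smooth_fun_mult) auto
        also have "\<dots> = (\<Sum>B\<in>K - {A}. ext_sign B (K - {A}) * nabla A P (nabla B Q (\<lambda>y. f y (K - {A} - {B}))) x)"
          using lt[OF A] x S by (intro sum.cong refl nabla_scale) auto
        finally show ?thesis .
      qed
      then have "ext_sign A K * nabla A P (\<lambda>y. d_op n Q f y (K - {A})) x = (\<Sum>B\<in>K - {A}. T P Q A B)"
        by (auto simp: T_def sum_distrib_left mult.assoc intro!: sum.cong)
      also have "\<dots> = (\<Sum>B\<in>K. T P Q A B)"
        using fin by (intro sum.mono_neutral_left) (auto simp: T_def)
      finally show ?thesis .
    qed
    then show ?thesis using True by (simp add: d_op_eq[of n P] cong: sum.cong)
  qed
  have "T P Q A B = - T Q P B A" if "A \<in> K" "B \<in> K" for A B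
  proof (cases "A = B")
    case False
    have "K - {A} - {B} = K - {B} - {A}" by auto
    then show ?thesis
      using False ext_sign_swap[OF fin that False] f x
        nabla_commute[OF lt[OF that(1)] lt[OF that(2)] esmoothD[OF f] x, of P Q "K - {A} - {B}"]
      by (simp add: T_def)
  qed (simp add: T_def)
  then have "(\<Sum>A\<in>K. \<Sum>B\<in>K. T P Q A B) = - (\<Sum>A\<in>K. \<Sum>B\<in>K. T Q P B A)"
    by (simp add: sum_negf cong: sum.cong)
  also have "(\<Sum>A\<in>K. \<Sum>B\<in>K. T Q P B A) = (\<Sum>A\<in>K. \<Sum>B\<in>K. T Q P A B)"
    by (rule sum.swap)
  finally show ?thesis by (simp add: E)
qed (simp add: d_op_eq)

lemma d_op_square: "esmooth f \<Longrightarrow> x \<in> \<Omega> \<Longrightarrow> d_op n P (d_op n P f) x K = 0"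
  using d_op_anticommute[of f x P P K] by (simp add: eq_neg_iff_add_eq_0)

lemma smooth_z_coord [simp]: "smooth (z_coord B P)"
  unfolding z_coord_linear by (intro smooth_fun_add smooth_fun_mult) simp_all

lemma wedge_d_add:
  "wedge_d n P z (\<lambda>y I. f y I + g y I) x K = wedge_d n P z f x K + wedge_d n P z g x K"
  by (simp add: wedge_d_def algebra_simps sum.distrib)

lemma wedge_d_mult:
  "wedge_d n P z (\<lambda>y I. w y * f y I) x K = w x * wedge_d n P z f x K"
  by (simp add: wedge_d_def algebra_simps sum_distrib_left)

section \<open>Contractions and the identities of the complex\<close>

definition ssmooth :: "(point \<Rightarrow> symext) \<Rightarrow> bool" where
  "ssmooth h \<longleftrightarrow> (\<forall>As. esmooth (\<lambda>x. h x As))"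

lemma ssmoothD: "ssmooth h \<Longrightarrow> esmooth (\<lambda>x. h x As)"
  by (simp add: ssmooth_def)

lemma ssmooth_dd: "ssmooth h \<Longrightarrow> ssmooth (dd n h)"
  unfolding ssmooth_def dd_def
  by (auto intro!: esmooth_add esmooth_d_op)

lemma ssmooth_contr: "ssmooth h \<Longrightarrow> ssmooth (contr B h)"
  unfolding ssmooth_def contr_def
  by (auto intro!: esmooth_add esmooth_mult)

text \<open>By the antisymmetry of d^{A'}z_B^{B'} all Leibniz corrections are, up to sign, values of
  the single operator \<open>wedge_d n P1 (z_coord B P0)\<close>; this is the normal form for the
  computations below.\<close>

lemma d_op_contr:
  assumes "ssmooth h" "x \<in> \<Omega>"
  shows "d_op n P (\<lambda>y. contr B h y As) x K =
    z_coord B P0 x * d_op n P (\<lambda>y. h y (P0 # As)) x K + z_coord B P1 x * d_op n P (\<lambda>y. h y (P1 # As)) x K +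
    (case P of P0 \<Rightarrow> - wedge_d n P1 (z_coord B P0) (\<lambda>y. h y (P1 # As)) x K
      | P1 \<Rightarrow> wedge_d n P1 (z_coord B P0) (\<lambda>y. h y (P0 # As)) x K)"
  unfolding contr_def using assms
  by (simp add: d_op_add d_op_mult esmooth_mult ssmoothD wedge_d_z_coord split: primed.split)

definition symmetric :: "(point \<Rightarrow> symext) \<Rightarrow> bool" where
  "symmetric h \<longleftrightarrow> (\<forall>x As Bs. mset As = mset Bs \<longrightarrow> h x As = h x Bs)"

lemma symmetric_swap: "symmetric h \<Longrightarrow> h x (P1 # P0 # As) = h x (P0 # P1 # As)"
  unfolding symmetric_def by (simp add: add_mset_commute)

text \<open>The corrections are minus that operator on the entry at \<open>P1 # P0 # As\<close>,
  from d^{0'}, and plus it on the entry at \<open>P0 # P1 # As\<close>, from d^{1'}; symmetry of h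
  cancels them.\<close>

lemma dd_contr:
  assumes h: "ssmooth h" "symmetric h" and x: "x \<in> \<Omega>"
  shows "dd n (contr B h) x As K = contr B (dd n h) x As K"
  by (simp add: dd_def contr_def[of B "dd n h"] d_op_contr[OF h(1) x] symmetric_swap[OF h(2)] algebra_simps)

lemma d_op_zero: "x \<in> \<Omega> \<Longrightarrow> d_op n P (\<lambda>y I. 0) x K = 0"
  using d_op_mult[of "\<lambda>_. 0" "\<lambda>y I. 0" x P K] d_op_add[of "\<lambda>y I. 0" "\<lambda>y I. 0" x P K]
  by (simp add: esmooth_def)

lemma d_op_eq_0: "(\<And>y I. y \<in> \<Omega> \<Longrightarrow> f y I = 0) \<Longrightarrow> x \<in> \<Omega> \<Longrightarrow> d_op n P f x K = 0"
  using d_op_cong[of f "\<lambda>y I. 0"] d_op_zero by simp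

lemma d_op_uminus:
  assumes "esmooth f" "x \<in> \<Omega>"
  shows "d_op n P (\<lambda>y I. - f y I) x K = - d_op n P f x K"
  using d_op_add[of f "\<lambda>y I. - f y I" x P K] d_op_zero assms
  by (simp add: esmooth_def smooth_fun_minus eq_neg_iff_add_eq_0 add.commute)

lemma dd_dd:
  assumes h: "ssmooth h" "symmetric h" and x: "x \<in> \<Omega>"
  shows "dd n (dd n h) x As K = 0"
proof -
  have *: "d_op n P (\<lambda>y. dd n h y Bs) x K =
      d_op n P (d_op n P0 (\<lambda>y. h y (P0 # Bs))) x K + d_op n P (d_op n P1 (\<lambda>y. h y (P1 # Bs))) x K" for P Bs
    unfolding dd_def using d_op_add[OF esmooth_d_op[OF ssmoothD[OF h(1)]] esmooth_d_op[OF ssmoothD[OF h(1)]] x] .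
  show ?thesis
    unfolding dd_def[of n "dd n h"] *
    using x h(1) d_op_anticommute[OF ssmoothD[OF h(1)] x, of P1 P0]
    by (simp add: d_op_square ssmoothD symmetric_swap[OF h(2)])
qed

text \<open>The inner d^{1'} kills the summand that starts with d^{1'}; in the other one, exchanging
  the outer operators produces a square of d^{0'}.\<close>

lemma d_op_d_op_dd:
  assumes h: "ssmooth h" and x: "x \<in> \<Omega>"
  shows "d_op n P0 (d_op n P1 (\<lambda>y. dd n h y As)) x K = 0"
proof -
  note S = ssmoothD[OF h] esmooth_d_op[OF ssmoothD[OF h]]
  have "d_op n P1 (\<lambda>y. dd n h y As) y I = d_op n P1 (d_op n P0 (\<lambda>y. h y (P0 # As))) y I"
    if "y \<in> \<Omega>" for y I
    unfolding dd_def using d_op_add[OF S(2,2) that] d_op_square[OF S(1) that] by simp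
  then have "d_op n P0 (d_op n P1 (\<lambda>y. dd n h y As)) x K =
      d_op n P0 (d_op n P1 (d_op n P0 (\<lambda>y. h y (P0 # As)))) x K"
    using x by (rule d_op_cong)
  also have "\<dots> = - d_op n P1 (d_op n P0 (d_op n P0 (\<lambda>y. h y (P0 # As)))) x K"
    using d_op_anticommute[OF S(2) x] .
  also have "\<dots> = 0"
    using d_op_eq_0[OF d_op_square[OF S(1)] x] by simp
  finally show ?thesis .
qed

text \<open>The corrections recombine as the main terms do: the outer derivative contributes the
  wedge with d^{1'}h_{1'} and, after passing through the inner wedge, the one with d^{0'}h_{0'};
  together these are the wedge with \<open>dd n h\<close>.\<close>

lemma d_op_d_op_contr:
  assumes h: "ssmooth h" and x: "x \<in> \<Omega>"
  shows "d_op n P0 (d_op n P1 (\<lambda>y. contr B h y As)) x K =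
    z_coord B P1 x * d_op n P0 (\<lambda>y. dd n h y As) x K - z_coord B P0 x * d_op n P1 (\<lambda>y. dd n h y As) x K
    - wedge_d n P1 (z_coord B P0) (\<lambda>y. dd n h y As) x K"
proof -
  let ?z0 = "z_coord B P0" and ?z1 = "z_coord B P1"
  let ?f0 = "\<lambda>y. h y (P0 # As)" and ?f1 = "\<lambda>y. h y (P1 # As)"
  let ?W = "wedge_d n P1 ?z0"
  note S = ssmoothD[OF h] esmooth_d_op[OF ssmoothD[OF h]]
  have W: "esmooth (?W ?f0)" by (intro esmooth_wedge_d S(1)) simp
  have "d_op n P0 (d_op n P1 (\<lambda>y. contr B h y As)) x K = d_op n P0 (\<lambda>y I.
      (?z0 y * d_op n P1 ?f0 y I + ?z1 y * d_op n P1 ?f1 y I) + ?W ?f0 y I) x K"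
    using x by (rule d_op_cong[rotated]) (simp add: d_op_contr[OF h])
  also have "\<dots> = ?z0 x * d_op n P0 (d_op n P1 ?f0) x K + ?z1 x * d_op n P0 (d_op n P1 ?f1) x K
      - ?W (d_op n P1 ?f1) x K + d_op n P0 (?W ?f0) x K"
    using x W S by (simp add: d_op_add d_op_mult esmooth_add esmooth_mult wedge_d_z_coord)
  also have "d_op n P0 (?W ?f0) x K = - ?W (d_op n P0 ?f0) x K"
  proof -
    \<comment> \<open>That d^{0'} anticommutes with the wedge by d^{1'}z_B^{0'} is read off from
      d^{0'}d^{0'} = 0 on z_B^{1'}h_{0'}, so second derivatives of z are never computed.\<close>
    have "0 = d_op n P0 (d_op n P0 (\<lambda>y I. ?z1 y * ?f0 y I)) x K"
      using d_op_square[OF esmooth_mult[OF smooth_z_coord S(1)] x] by simp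
    also have "\<dots> = d_op n P0 (\<lambda>y I. ?z1 y * d_op n P0 ?f0 y I + - ?W ?f0 y I) x K"
      using x by (rule d_op_cong[rotated]) (simp add: d_op_mult S wedge_d_z_coord)
    also have "\<dots> = - ?W (d_op n P0 ?f0) x K - d_op n P0 (?W ?f0) x K"
      using x W S
      by (subst d_op_add)
        (auto simp: d_op_mult d_op_square d_op_uminus esmooth_mult wedge_d_z_coord esmooth_def smooth_fun_minus)
    finally show ?thesis by (simp add: algebra_simps eq_neg_iff_add_eq_0)
  qed
  finally show ?thesis
    using x S unfolding dd_def
    by (simp add: d_op_add d_op_square wedge_d_add d_op_anticommute[of ?f0 x P1 P0] algebra_simps)
qed

text \<open>Each row of z meets a contraction of v by the other row. The coefficients of
  d^{0'}v_{0'} and d^{1'}v_{1'} are therefore the determinant, those of d^{0'}v_{1'} and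
  d^{1'}v_{0'} are minors with a repeated column, and the corrections cancel in pairs.\<close>

lemma d_op_d_op_lift:
  assumes "ssmooth f" "ssmooth g" and v: "ssmooth v" and x: "x \<in> \<Omega>"
    and f: "\<And>y I. y \<in> \<Omega> \<Longrightarrow> dd n f y As I = - contr 1 v y As I"
    and g: "\<And>y I. y \<in> \<Omega> \<Longrightarrow> dd n g y As I = contr 0 v y As I"
  shows "d_op n P0 (d_op n P1 (\<lambda>y I. contr 0 f y As I + contr 1 g y As I)) x K = zdet x * dd n v x As K"
proof -
  have dF: "d_op n P (\<lambda>y. dd n f y As) x K = - d_op n P (\<lambda>y. contr 1 v y As) x K" for P
    using d_op_cong[of "\<lambda>y. dd n f y As" "\<lambda>y I. - contr 1 v y As I" x P K] f x
      d_op_uminus[OF ssmoothD[OF ssmooth_contr[OF v]] x] by simp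
  have dG: "d_op n P (\<lambda>y. dd n g y As) x K = d_op n P (\<lambda>y. contr 0 v y As) x K" for P
    using d_op_cong[of "\<lambda>y. dd n g y As" "\<lambda>y I. contr 0 v y As I" x P K] g x by simp
  have W: "wedge_d n P1 z (\<lambda>y. contr B v y As) x K =
      z_coord B P0 x * wedge_d n P1 z (\<lambda>y. v y (P0 # As)) x K + z_coord B P1 x * wedge_d n P1 z (\<lambda>y. v y (P1 # As)) x K"
    for z B
    unfolding contr_def by (simp add: wedge_d_add wedge_d_mult)
  have WF: "wedge_d n P1 z (\<lambda>y. dd n f y As) x K = - wedge_d n P1 z (\<lambda>y. contr 1 v y As) x K" for z
    unfolding wedge_d_def using f[OF x] by (simp add: sum_negf)
  have WG: "wedge_d n P1 z (\<lambda>y. dd n g y As) x K = wedge_d n P1 z (\<lambda>y. contr 0 v y As) x K" for z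
    unfolding wedge_d_def using g[OF x] by simp
  have "d_op n P0 (d_op n P1 (\<lambda>y I. contr 0 f y As I + contr 1 g y As I)) x K =
      d_op n P0 (\<lambda>y I. d_op n P1 (\<lambda>y. contr 0 f y As) y I + d_op n P1 (\<lambda>y. contr 1 g y As) y I) x K"
    using x by (rule d_op_cong[rotated]) (simp add: d_op_add assms(1,2) ssmoothD ssmooth_contr)
  also have "\<dots> = d_op n P0 (d_op n P1 (\<lambda>y. contr 0 f y As)) x K + d_op n P0 (d_op n P1 (\<lambda>y. contr 1 g y As)) x K"
    using x assms(1,2) by (intro d_op_add esmooth_d_op ssmoothD ssmooth_contr)
  also have "\<dots> = zdet x * dd n v x As K"
    unfolding d_op_d_op_contr[OF assms(1) x] d_op_d_op_contr[OF assms(2) x] dF dG WF WG W d_op_contr[OF v x]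
    by (simp add: dd_def zdet_def algebra_simps)
  finally show ?thesis .
qed

end

section \<open>Quotients of additive groups\<close>

definition add_subgroup :: "'a::ab_group_add set \<Rightarrow> bool" where
  "add_subgroup S \<longleftrightarrow> 0 \<in> S \<and> (\<forall>x\<in>S. \<forall>y\<in>S. x - y \<in> S)"

lemma add_subgroupD:
  assumes "add_subgroup S"
  shows "0 \<in> S" "x \<in> S \<Longrightarrow> - x \<in> S" "x \<in> S \<Longrightarrow> y \<in> S \<Longrightarrow> x + y \<in> S" "x \<in> S \<Longrightarrow> y \<in> S \<Longrightarrow> x - y \<in> S"
proof -
  show 0: "0 \<in> S" and d: "\<And>x y. x \<in> S \<Longrightarrow> y \<in> S \<Longrightarrow> x - y \<in> S"
    using assms by (auto simp: add_subgroup_def)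
  show m: "- x \<in> S" if "x \<in> S" for x using d[OF 0 that] by simp
  show "x + y \<in> S" if "x \<in> S" "y \<in> S" using d[OF that(1) m[OF that(2)]] by simp
qed

lemma add_subgroup_Times: "add_subgroup S \<Longrightarrow> add_subgroup T \<Longrightarrow> add_subgroup (S \<times> T)"
  by (auto simp: add_subgroup_def zero_prod_def)

text \<open>A bridge from pointwise addition as a type class operation to group records;
  \<open>cocycles n \<Omega> m j\<close> has this form by
  \<open>cocycles_add_monoid_on\<close>.\<close>

definition add_monoid_on :: "'a::ab_group_add set \<Rightarrow> 'a monoid" where
  "add_monoid_on S = \<lparr>carrier = S, mult = (+), one = 0\<rparr>"

lemma comm_group_add_monoid_on:
  assumes "add_subgroup S"
  shows "comm_group (add_monoid_on S)"
proof (rule comm_groupI)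
  fix x assume "x \<in> carrier (add_monoid_on S)"
  then show "\<exists>y\<in>carrier (add_monoid_on S). y \<otimes>\<^bsub>add_monoid_on S\<^esub> x = \<one>\<^bsub>add_monoid_on S\<^esub>"
    using add_subgroupD[OF assms] by (intro bexI[of _ "- x"]) (auto simp: add_monoid_on_def)
qed (use add_subgroupD[OF assms] in \<open>auto simp: add_monoid_on_def algebra_simps\<close>)

lemma normal_add_monoid_on:
  assumes "add_subgroup S" "add_subgroup B" "B \<subseteq> S"
  shows "B \<lhd> add_monoid_on S"
proof -
  interpret comm_group "add_monoid_on S" using comm_group_add_monoid_on[OF assms(1)] .
  have "subgroup B (add_monoid_on S)"
  proof (rule subgroupI)
    show "inv\<^bsub>add_monoid_on S\<^esub> a \<in> B" if "a \<in> B" for a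
    proof -
      have "inv\<^bsub>add_monoid_on S\<^esub> a = - a"
        using that assms(3) add_subgroupD(2)[OF assms(1)]
        by (intro inv_equality) (auto simp: add_monoid_on_def)
      then show ?thesis using add_subgroupD(2)[OF assms(2) that] by simp
    qed
  qed (use assms(3) add_subgroupD[OF assms(2)] in \<open>auto simp: add_monoid_on_def\<close>)
  then show ?thesis by (rule subgroup_imp_normal)
qed

text \<open>\<open>Q\<close> is the quotient \<open>Z / B\<close>, with \<open>c\<close> the quotient map.\<close>

definition presents :: "('q, 'r) monoid_scheme \<Rightarrow> 'a::ab_group_add set \<Rightarrow> 'a set \<Rightarrow> ('a \<Rightarrow> 'q) \<Rightarrow> bool" where
  "presents Q Z B c \<longleftrightarrow> group Q \<and> add_subgroup Z \<and> add_subgroup B \<and> B \<subseteq> Z \<and> carrier Q = c ` Z \<and>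
     (\<forall>x\<in>Z. \<forall>y\<in>Z. c x \<otimes>\<^bsub>Q\<^esub> c y = c (x + y) \<and> (c x = c y \<longleftrightarrow> x - y \<in> B))"

lemma presentsD:
  assumes "presents Q Z B c"
  shows "group Q" "add_subgroup Z" "add_subgroup B" "B \<subseteq> Z" "carrier Q = c ` Z"
    "x \<in> Z \<Longrightarrow> y \<in> Z \<Longrightarrow> c x \<otimes>\<^bsub>Q\<^esub> c y = c (x + y)"
    "x \<in> Z \<Longrightarrow> y \<in> Z \<Longrightarrow> c x = c y \<longleftrightarrow> x - y \<in> B"
  using assms by (auto simp: presents_def)

lemma presents_eq_one:
  assumes "presents Q Z B c" "x \<in> Z"
  shows "c x = \<one>\<^bsub>Q\<^esub> \<longleftrightarrow> x \<in> B"
proof -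
  note P = presentsD[OF assms(1)]
  interpret group Q by (rule P(1))
  have Z0: "0 \<in> Z" using P(2) add_subgroupD(1) by blast
  have "c 0 \<otimes>\<^bsub>Q\<^esub> c 0 = c 0" using P(6)[OF Z0 Z0] by simp
  moreover have "c 0 \<in> carrier Q" using P(5) Z0 by blast
  ultimately have "c 0 = \<one>\<^bsub>Q\<^esub>" using l_cancel_one[of "c 0" "c 0"] by simp
  then show ?thesis using P(7)[OF assms(2) Z0] by simp
qed

lemma r_coset_add_monoid_on: "B #>\<^bsub>add_monoid_on Z\<^esub> f = (\<lambda>h. h + f) ` B"
  by (auto simp: r_coset_def add_monoid_on_def)

lemma presents_Mod:
  assumes "add_subgroup Z" "add_subgroup B" "B \<subseteq> Z"
  shows "presents (add_monoid_on Z Mod B) Z B (\<lambda>f. B #>\<^bsub>add_monoid_on Z\<^esub> f)"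
proof -
  interpret N: normal B "add_monoid_on Z" by (rule normal_add_monoid_on[OF assms])
  have c: "carrier (add_monoid_on Z Mod B) = (\<lambda>f. B #>\<^bsub>add_monoid_on Z\<^esub> f) ` Z"
    by (auto simp: FactGroup_def RCOSETS_def add_monoid_on_def)
  have m: "(B #>\<^bsub>add_monoid_on Z\<^esub> x) \<otimes>\<^bsub>add_monoid_on Z Mod B\<^esub> (B #>\<^bsub>add_monoid_on Z\<^esub> y) = B #>\<^bsub>add_monoid_on Z\<^esub> (x + y)"
    if "x \<in> Z" "y \<in> Z" for x y
    using N.rcos_sum[of x y] that by (simp add: FactGroup_def) (simp add: add_monoid_on_def)
  have e: "B #>\<^bsub>add_monoid_on Z\<^esub> x = B #>\<^bsub>add_monoid_on Z\<^esub> y \<longleftrightarrow> x - y \<in> B" for x y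
  proof
    assume "B #>\<^bsub>add_monoid_on Z\<^esub> x = B #>\<^bsub>add_monoid_on Z\<^esub> y"
    moreover have "0 + x \<in> B #>\<^bsub>add_monoid_on Z\<^esub> x"
      unfolding r_coset_add_monoid_on using add_subgroupD(1)[OF assms(2)] by blast
    ultimately obtain b where "b \<in> B" "x = b + y" unfolding r_coset_add_monoid_on by auto
    then show "x - y \<in> B" by simp
  next
    assume d: "x - y \<in> B"
    have "h + x \<in> (\<lambda>h. h + y) ` B" if "h \<in> B" for h
      using add_subgroupD(3)[OF assms(2) that d] by (intro image_eqI[of _ _ "h + (x - y)"]) auto
    moreover have "h + y \<in> (\<lambda>h. h + x) ` B" if "h \<in> B" for h
      using add_subgroupD(4)[OF assms(2) that d] by (intro image_eqI[of _ _ "h - (x - y)"]) auto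
    ultimately show "B #>\<^bsub>add_monoid_on Z\<^esub> x = B #>\<^bsub>add_monoid_on Z\<^esub> y"
      unfolding r_coset_add_monoid_on by blast
  qed
  show ?thesis
    unfolding presents_def using assms c m e N.factorgroup_is_group by simp
qed

lemma presents_DirProd:
  assumes "presents Q Z B c" "presents Q' Z' B' c'"
  shows "presents (Q \<times>\<times> Q') (Z \<times> Z') (B \<times> B') (\<lambda>u. (c (fst u), c' (snd u)))"
proof -
  note P = presentsD[OF assms(1)] and P' = presentsD[OF assms(2)]
  have "(\<lambda>u. (c (fst u), c' (snd u))) ` (Z \<times> Z') = c ` Z \<times> c' ` Z'"
    by (auto simp: image_iff)
  then show ?thesis
    unfolding presents_def
    using P P' DirProd_group[OF P(1) P'(1)] add_subgroup_Times[OF P(2) P'(2)] add_subgroup_Times[OF P(3) P'(3)]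
    by (auto simp: DirProd_def)
qed

text \<open>A map \<open>\<phi>\<close> of quotients given by the additive relation \<open>R\<close> between representatives.\<close>

definition induces ::
  "'a::ab_group_add set \<Rightarrow> ('a \<Rightarrow> 'q) \<Rightarrow> 'b::ab_group_add set \<Rightarrow> ('b \<Rightarrow> 'q') \<Rightarrow> ('a \<Rightarrow> 'b \<Rightarrow> bool) \<Rightarrow> ('q \<Rightarrow> 'q') \<Rightarrow> bool" where
  "induces Z c Z' c' R \<phi> \<longleftrightarrow> (\<forall>x\<in>Z. \<exists>y. R x y) \<and> (\<forall>x\<in>Z. \<forall>y. R x y \<longrightarrow> y \<in> Z' \<and> \<phi> (c x) = c' y) \<and>
     (\<forall>x x' y y'. R x y \<longrightarrow> R x' y' \<longrightarrow> R (x + x') (y + y'))"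

lemma induces_group_hom:
  assumes "presents Q Z B c" "presents Q' Z' B' c'" "induces Z c Z' c' R \<phi>"
  shows "group_hom Q Q' \<phi>"
proof -
  note P = presentsD[OF assms(1)] and P' = presentsD[OF assms(2)]
  have "\<phi> \<in> hom Q Q'"
  proof (rule homI)
    fix q assume "q \<in> carrier Q"
    then show "\<phi> q \<in> carrier Q'"
      using P(5) P'(5) assms(3) unfolding induces_def by fastforce
  next
    fix q r assume "q \<in> carrier Q" "r \<in> carrier Q"
    then obtain x y where xy: "x \<in> Z" "y \<in> Z" "q = c x" "r = c y" using P(5) by auto
    obtain x' y' where R: "R x x'" "R y y'" using xy assms(3) unfolding induces_def by blast
    have "x + y \<in> Z" using xy add_subgroupD(3)[OF P(2)] by blast
    then show "\<phi> (q \<otimes>\<^bsub>Q\<^esub> r) = \<phi> q \<otimes>\<^bsub>Q'\<^esub> \<phi> r"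
      using xy R P(6) P'(6) assms(3) unfolding induces_def by metis
  qed
  then show ?thesis using P(1) P'(1) by (simp add: group_hom_def group_hom_axioms_def)
qed

text \<open>What exactness asks of representatives: \<open>zero\<close> and \<open>lift\<close> are
  the two diagram chases. The relations may be many-valued, so \<open>zero\<close> is demanded for
  every choice, while \<open>lift\<close> has to produce only one.\<close>

lemma induces_exact:
  assumes P1: "presents Q1 Z1 B1 c1" and P2: "presents Q2 Z2 B2 c2" and P3: "presents Q3 Z3 B3 c3"
    and R: "induces Z1 c1 Z2 c2 R \<phi>" and S: "induces Z2 c2 Z3 c3 S \<psi>"
    and zero: "\<And>x y w. x \<in> Z1 \<Longrightarrow> R x y \<Longrightarrow> S y w \<Longrightarrow> w \<in> B3"
    and lift: "\<And>y w. y \<in> Z2 \<Longrightarrow> S y w \<Longrightarrow> w \<in> B3 \<Longrightarrow> \<exists>x\<in>Z1. \<exists>y'. R x y' \<and> y - y' \<in> B2"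
  shows "\<phi> ` carrier Q1 = kernel Q2 Q3 \<psi>"
proof (intro subset_antisym subsetI)
  fix q assume "q \<in> \<phi> ` carrier Q1"
  then obtain x where x: "x \<in> Z1" "q = \<phi> (c1 x)" using presentsD(5)[OF P1] by auto
  then obtain y where y: "R x y" "y \<in> Z2" "q = c2 y" using R unfolding induces_def by metis
  then obtain w where w: "S y w" "w \<in> Z3" "\<psi> q = c3 w" using S unfolding induces_def by metis
  then show "q \<in> kernel Q2 Q3 \<psi>"
    using zero[OF x(1) y(1) w(1)] y presentsD(5)[OF P2] presents_eq_one[OF P3 w(2)]
    by (auto simp: kernel_def)
next
  fix q assume "q \<in> kernel Q2 Q3 \<psi>"
  then obtain y where y: "y \<in> Z2" "q = c2 y" "\<psi> q = \<one>\<^bsub>Q3\<^esub>"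
    using presentsD(5)[OF P2] by (auto simp: kernel_def)
  then obtain w where w: "S y w" "w \<in> Z3" "\<psi> q = c3 w" using S unfolding induces_def by metis
  then have "w \<in> B3" using y presents_eq_one[OF P3 w(2)] by simp
  then obtain x y' where x: "x \<in> Z1" "R x y'" "y - y' \<in> B2" using lift y(1) w(1) by blast
  then have "y' \<in> Z2" "\<phi> (c1 x) = c2 y'" using R unfolding induces_def by auto
  moreover have "c2 y = c2 y'" using presentsD(7)[OF P2 y(1) \<open>y' \<in> Z2\<close>] x(3) by simp
  ultimately show "q \<in> \<phi> ` carrier Q1"
    using y(2) x(1) presentsD(5)[OF P1] by (metis imageI)
qed

text \<open>The maps on cohomology are unique elements of images over all choices; this evaluates
  them once independence of the choices is known.\<close>

lemma the_elem_constant: "x \<in> C \<Longrightarrow> (\<And>x. x \<in> C \<Longrightarrow> F x = y) \<Longrightarrow> the_elem (F ` C) = y"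
proof -
  assume "x \<in> C" and F: "\<And>x. x \<in> C \<Longrightarrow> F x = y"
  then have "F ` C = {y}" by (auto intro!: image_eqI[of y F x])
  then show ?thesis by simp
qed

section \<open>Symmetrisation, gluing and spaces of sections\<close>

text \<open>The sum over all positions of w at that index times f at the remaining string; for
  symmetric f, positions with equal index give equal terms, hence the multiplicities. The divisor
  exceeds the number of positions by one because the contraction in \<open>L_map_surj\<close>
  returns that many copies of f.\<close>

definition sym_insert :: "(point \<Rightarrow> complex) \<Rightarrow> (point \<Rightarrow> complex) \<Rightarrow> (point \<Rightarrow> symext) \<Rightarrow> point \<Rightarrow> symext" where
  "sym_insert w0 w1 f x As I =
     (of_nat (count (mset As) P0) * w0 x * f x (remove1 P0 As) I +
      of_nat (count (mset As) P1) * w1 x * f x (remove1 P1 As) I) / of_nat (length As + 1)"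

text \<open>Rebuilds a family from its entries with first index 0' and with first index 1'. A family
  with at least one index has no entry at \<open>[]\<close>, hence the 0.\<close>

definition glue :: "(point \<Rightarrow> symext) \<Rightarrow> (point \<Rightarrow> symext) \<Rightarrow> point \<Rightarrow> symext" where
  "glue a b x As I = (case As of [] \<Rightarrow> 0 | P # Bs \<Rightarrow> (case P of P0 \<Rightarrow> a x Bs I | P1 \<Rightarrow> b x Bs I))"

lemma count_primed: "count (mset As) P0 + count (mset As) P1 = length As"
proof (induction As)
  case (Cons P As)
  then show ?case by (cases P) auto
qed simp

lemma L_map_contr: "L_map u = contr 0 (fst u) + contr 1 (snd u)"
  by (simp add: L_map_def contr_def fun_eq_iff)

lemma Lt_map_contr: "Lt_map h = (- contr 1 h, contr 0 h)"
  by (auto simp: Lt_map_def contr_def fun_eq_iff)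

lemma contr_additive [simp]:
  "contr B (f + g) = contr B f + contr B g" "contr B (f - g) = contr B f - contr B g"
  "contr B (- f) = - contr B f" "contr B 0 = 0"
  by (auto simp: contr_def fun_eq_iff algebra_simps)

lemma L_map_additive [simp]:
  "L_map (u + v) = L_map u + L_map v" "L_map (u - v) = L_map u - L_map v" "L_map 0 = 0"
  by (simp_all add: L_map_contr)

lemma Lt_map_additive [simp]:
  "Lt_map (f + g) = Lt_map f + Lt_map g" "Lt_map (f - g) = Lt_map f - Lt_map g" "Lt_map 0 = 0"
  by (simp_all add: Lt_map_contr zero_prod_def)

context quat_region
begin

definition SS :: "nat \<Rightarrow> nat \<Rightarrow> (point \<Rightarrow> symext) set" where
  "SS p d = smooth_sections n \<Omega> (sym_ext_space n p d)"

lemma SS_iff: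
  "f \<in> SS p d \<longleftrightarrow> ssmooth f \<and> symmetric f \<and>
     (\<forall>x As I. f x As I \<noteq> 0 \<longrightarrow> x \<in> \<Omega> \<and> length As = p \<and> I \<subseteq> {..<2 * n} \<and> card I = d)"
proof
  assume "f \<in> SS p d"
  then have f: "\<And>x. x \<in> \<Omega> \<Longrightarrow> f x \<in> sym_ext_space n p d" "\<And>x. x \<notin> \<Omega> \<Longrightarrow> f x = (\<lambda>_ _. 0)"
    "\<And>As I. smooth (\<lambda>x. f x As I)"
    unfolding SS_def smooth_sections_def by auto
  have "symmetric f" unfolding symmetric_def
  proof (intro allI impI)
    fix x As Bs assume "mset As = mset (Bs :: primed list)"
    then show "f x As = f x Bs"
      using f(1)[of x] f(2)[of x] unfolding sym_ext_space_def by (cases "x \<in> \<Omega>") (blast, simp)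
  qed
  moreover have "x \<in> \<Omega> \<and> length As = p \<and> I \<subseteq> {..<2 * n} \<and> card I = d" if "f x As I \<noteq> 0" for x As I
    using f(1)[of x] f(2)[of x] that unfolding sym_ext_space_def by (cases "x \<in> \<Omega>") (blast, simp)
  ultimately show "ssmooth f \<and> symmetric f \<and>
     (\<forall>x As I. f x As I \<noteq> 0 \<longrightarrow> x \<in> \<Omega> \<and> length As = p \<and> I \<subseteq> {..<2 * n} \<and> card I = d)"
    using f(3) by (simp add: ssmooth_def esmooth_def)
next
  assume A: "ssmooth f \<and> symmetric f \<and>
     (\<forall>x As I. f x As I \<noteq> 0 \<longrightarrow> x \<in> \<Omega> \<and> length As = p \<and> I \<subseteq> {..<2 * n} \<and> card I = d)"
  have "f x \<in> sym_ext_space n p d" for x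
    using A unfolding sym_ext_space_def symmetric_def by blast
  moreover have "f x = (\<lambda>_ _. 0)" if "x \<notin> \<Omega>" for x
    using A that by blast
  ultimately show "f \<in> SS p d"
    using A by (simp add: SS_def smooth_sections_def ssmooth_def esmooth_def)
qed

lemma SS_D:
  assumes "f \<in> SS p d"
  shows "ssmooth f" "symmetric f" "x \<notin> \<Omega> \<Longrightarrow> f x = 0" "length As \<noteq> p \<Longrightarrow> f x As = 0"
    "f x As I \<noteq> 0 \<Longrightarrow> x \<in> \<Omega> \<and> length As = p \<and> I \<subseteq> {..<2 * n} \<and> card I = d"
  using assms unfolding SS_iff by (auto simp: fun_eq_iff)

lemma ssmooth_lin:
  assumes "ssmooth f" "ssmooth g" "smooth a" "smooth b"
  shows "ssmooth (\<lambda>x As I. a x * f x As I + b x * g x As I)"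
  using assms unfolding ssmooth_def esmooth_def by (auto intro!: smooth_fun_add smooth_fun_mult)

text \<open>The coefficients are controlled on \<Omega> alone, as for the inverse of
  \<open>zdet\<close>; elsewhere f and g are 0.\<close>

lemma SS_lin:
  assumes f: "f \<in> SS p d" and g: "g \<in> SS p d" and ab: "smooth a" "smooth b"
  shows "(\<lambda>x As I. a x * f x As I + b x * g x As I) \<in> SS p d"
  unfolding SS_iff
proof (intro conjI allI impI)
  show "ssmooth (\<lambda>x As I. a x * f x As I + b x * g x As I)"
    using ssmooth_lin SS_D(1) assms by blast
  show "symmetric (\<lambda>x As I. a x * f x As I + b x * g x As I)"
    using SS_D(2)[OF f] SS_D(2)[OF g] unfolding symmetric_def by metis
qed (metis add_0 mult_zero_right SS_D(5)[OF f] SS_D(5)[OF g])+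

lemma add_subgroup_SS: "add_subgroup (SS p d)"
proof -
  have Z: "0 \<in> SS p d"
    unfolding SS_iff by (auto simp: ssmooth_def esmooth_def symmetric_def)
  show ?thesis unfolding add_subgroup_def
  proof (intro conjI ballI Z)
    fix f g assume fg: "f \<in> SS p d" "g \<in> SS p d"
    have "f - g = (\<lambda>x As I. 1 * f x As I + (- 1) * g x As I)" by (auto simp: fun_eq_iff)
    then show "f - g \<in> SS p d" using SS_lin[OF fg, of "\<lambda>_. 1" "\<lambda>_. - 1"] by simp
  qed
qed

lemmas SS_add = add_subgroupD(3)[OF add_subgroup_SS]
  and SS_uminus = add_subgroupD(2)[OF add_subgroup_SS]
  and SS_diff = add_subgroupD(4)[OF add_subgroup_SS]
  and SS_zero = add_subgroupD(1)[OF add_subgroup_SS]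

lemma contr_SS:
  assumes h: "h \<in> SS (Suc p) d"
  shows "contr B h \<in> SS p d"
  unfolding SS_iff
proof (intro conjI allI impI)
  show "ssmooth (contr B h)" using ssmooth_contr SS_D(1)[OF h] by blast
  show "symmetric (contr B h)" unfolding symmetric_def
  proof (intro allI impI)
    fix x As Bs assume "mset As = mset (Bs :: primed list)"
    then have "mset (P # As) = mset (P # Bs)" for P by simp
    then have "h x (P # As) = h x (P # Bs)" for P using SS_D(2)[OF h] unfolding symmetric_def by blast
    then show "contr B h x As = contr B h x Bs" by (simp add: contr_def fun_eq_iff)
  qed
  fix x As I assume "contr B h x As I \<noteq> 0"
  then obtain P where "h x (P # As) I \<noteq> 0" unfolding contr_def by force
  from SS_D(5)[OF h this] show "x \<in> \<Omega>" "length As = p" "I \<subseteq> {..<2 * n}" "card I = d" by auto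
qed

definition D1 :: "(point \<Rightarrow> symext) \<Rightarrow> point \<Rightarrow> symext" where
  "D1 f = (\<lambda>x. if x \<in> \<Omega> then dd n f x else 0)"

definition D2 :: "(point \<Rightarrow> symext) \<Rightarrow> point \<Rightarrow> symext" where
  "D2 f = (\<lambda>x. if x \<in> \<Omega> then \<lambda>As K. d_op n P0 (d_op n P1 (\<lambda>y. f y As)) x K else 0)"

lemma CF_op_D: "CF_op n \<Omega> m j f = (if j < m then D1 f else D2 f)"
  by (auto simp: CF_op_def D1_def D2_def dd_def fun_eq_iff)

lemma ssmooth_cong:
  assumes "\<And>x. x \<in> \<Omega> \<Longrightarrow> f x = g x" "ssmooth f"
  shows "ssmooth g"
  unfolding ssmooth_def esmooth_def
proof (intro allI)
  fix As I
  show "smooth (\<lambda>x. g x As I)"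
    by (rule smooth_fun_cong[of "\<lambda>x. f x As I"]) (use assms in \<open>auto simp: ssmooth_def esmooth_def\<close>)
qed

lemma D1_SS:
  assumes f: "f \<in> SS (Suc p) d"
  shows "D1 f \<in> SS p (Suc d)"
  unfolding SS_iff
proof (intro conjI allI impI)
  show "ssmooth (D1 f)"
    by (rule ssmooth_cong[of "dd n f"]) (auto simp: D1_def intro: ssmooth_dd SS_D(1)[OF f])
  show "symmetric (D1 f)" unfolding symmetric_def
  proof (intro allI impI)
    fix x As Bs assume "mset As = mset (Bs :: primed list)"
    then have "mset (P # As) = mset (P # Bs)" for P by simp
    then have "(\<lambda>x. f x (P # As)) = (\<lambda>x. f x (P # Bs))" for P
      using SS_D(2)[OF f] unfolding symmetric_def by blast
    then show "D1 f x As = D1 f x Bs" by (simp add: D1_def dd_def[abs_def])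
  qed
  fix x As K assume nz: "D1 f x As K \<noteq> 0"
  then show x: "x \<in> \<Omega>" by (auto simp: D1_def split: if_splits)
  then obtain P where P: "d_op n P (\<lambda>y. f y (P # As)) x K \<noteq> 0" using nz unfolding D1_def dd_def by force
  then have K: "K \<subseteq> {..<2 * n}" by (auto simp: d_op_eq split: if_splits)
  then show "K \<subseteq> {..<2 * n}" .
  have "(\<Sum>A\<in>K. ext_sign A K * nabla A P (\<lambda>y. f y (P # As) (K - {A})) x) \<noteq> 0"
    using P K by (simp add: d_op_eq)
  then obtain A where A: "A \<in> K" "nabla A P (\<lambda>y. f y (P # As) (K - {A})) x \<noteq> 0"
    by (metis (no_types, lifting) mult_zero_right sum.neutral)
  \<comment> \<open>An identically vanishing coefficient has derivative 0, so f has a nonzero value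
    at this string and index set, and its support conditions carry over.\<close>
  obtain y where "f y (P # As) (K - {A}) \<noteq> 0"
  proof (rule ccontr)
    assume "\<not> thesis"
    then have "(\<lambda>y. f y (P # As) (K - {A})) = (\<lambda>y. 0)" using that by blast
    then show False using A nabla_const[of A P 0 x] K by auto
  qed
  from SS_D(5)[OF f this] show "length As = p" "card K = Suc d"
    using A(1) K finite_subset[OF K] card_Suc_Diff1[of K A] by auto
qed

lemma dd_diff: "ssmooth f \<Longrightarrow> ssmooth g \<Longrightarrow> x \<in> \<Omega> \<Longrightarrow> dd n (f - g) x = dd n f x - dd n g x"
proof (rule ext, rule ext)
  fix As K assume fg: "ssmooth f" "ssmooth g" "x \<in> \<Omega>"
  have "d_op n P (\<lambda>y. (f - g) y As) x K = d_op n P (\<lambda>y. f y As) x K - d_op n P (\<lambda>y. g y As) x K" for P As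
    using d_op_add[of "\<lambda>y. f y As" "\<lambda>y I. - g y As I" x P K] d_op_uminus[of "\<lambda>y. g y As" x P K] fg
    by (simp add: ssmooth_def esmooth_def smooth_fun_minus fun_diff_def)
  then show "dd n (f - g) x As K = (dd n f x - dd n g x) As K" by (simp add: dd_def)
qed

end

section \<open>The maps on sections\<close>

context quat_region
begin

lemma d_op_diff:
  assumes "esmooth f" "esmooth g" "x \<in> \<Omega>"
  shows "d_op n P (\<lambda>y I. f y I - g y I) x K = d_op n P f x K - d_op n P g x K"
  using d_op_add[of f "\<lambda>y I. - g y I" x P K] d_op_uminus[of g x P K] assms
  by (simp add: esmooth_def smooth_fun_minus)

lemma D1_diff: "ssmooth f \<Longrightarrow> ssmooth g \<Longrightarrow> D1 (f - g) = D1 f - D1 g"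
  by (auto simp: D1_def dd_diff fun_eq_iff)

lemma D2_diff:
  assumes "ssmooth f" "ssmooth g"
  shows "D2 (f - g) = D2 f - D2 g"
proof -
  have "d_op n P0 (d_op n P1 (\<lambda>y. (f - g) y As)) x K =
      d_op n P0 (d_op n P1 (\<lambda>y. f y As)) x K - d_op n P0 (d_op n P1 (\<lambda>y. g y As)) x K"
    if x: "x \<in> \<Omega>" for x As K
  proof -
    have "d_op n P0 (d_op n P1 (\<lambda>y. (f - g) y As)) x K =
        d_op n P0 (\<lambda>y I. d_op n P1 (\<lambda>y. f y As) y I - d_op n P1 (\<lambda>y. g y As) y I) x K"
      using x by (rule d_op_cong[rotated]) (simp add: d_op_diff[symmetric] ssmoothD assms fun_diff_def)
    then show ?thesis
      using x assms by (simp add: d_op_diff esmooth_d_op ssmoothD)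
  qed
  then show ?thesis by (auto simp: D2_def fun_eq_iff)
qed

lemma D1_zero [simp]: "D1 0 = 0"
  using D1_diff[OF SS_D(1)[OF SS_zero] SS_D(1)[OF SS_zero]] by simp

lemma D2_zero [simp]: "D2 0 = 0"
  using D2_diff[OF SS_D(1)[OF SS_zero] SS_D(1)[OF SS_zero]] by simp

lemma ssmooth_zero: "ssmooth 0"
  using SS_D(1)[OF SS_zero] .

lemma ssmooth_uminus: "ssmooth f \<Longrightarrow> ssmooth (- f)"
  by (simp add: ssmooth_def esmooth_def smooth_fun_minus)

lemma D1_uminus: "ssmooth f \<Longrightarrow> D1 (- f) = - D1 f"
  using D1_diff[OF ssmooth_zero, of f] by simp

lemma D1_add: "ssmooth f \<Longrightarrow> ssmooth g \<Longrightarrow> D1 (f + g) = D1 f + D1 g"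
  using D1_diff[of f "- g"] D1_uminus[of g] ssmooth_uminus[of g] by simp

lemma D2_uminus: "ssmooth f \<Longrightarrow> D2 (- f) = - D2 f"
  using D2_diff[OF ssmooth_zero, of f] by simp

lemma D1_contr: "ssmooth h \<Longrightarrow> symmetric h \<Longrightarrow> D1 (contr B h) = contr B (D1 h)"
  by (rule ext)+ (simp add: D1_def dd_contr, simp add: contr_def)

lemma dd_cong: "(\<And>y. y \<in> \<Omega> \<Longrightarrow> f y = g y) \<Longrightarrow> x \<in> \<Omega> \<Longrightarrow> dd n f x As K = dd n g x As K"
  unfolding dd_def
  using d_op_cong[of "\<lambda>y. f y (P0 # As)" "\<lambda>y. g y (P0 # As)" x P0 K]
    d_op_cong[of "\<lambda>y. f y (P1 # As)" "\<lambda>y. g y (P1 # As)" x P1 K] by simp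

lemma D1_D1: "ssmooth f \<Longrightarrow> symmetric f \<Longrightarrow> D1 (D1 f) = 0"
  using dd_cong[of "D1 f" "dd n f"] by (auto simp: fun_eq_iff D1_def dd_dd)

lemma D2_D1:
  assumes "ssmooth f"
  shows "D2 (D1 f) = 0"
proof -
  have "d_op n P0 (d_op n P1 (\<lambda>y. D1 f y As)) x K = 0" if x: "x \<in> \<Omega>" for x As K
  proof -
    have "d_op n P0 (d_op n P1 (\<lambda>y. D1 f y As)) x K = d_op n P0 (d_op n P1 (\<lambda>y. dd n f y As)) x K"
      using x by (intro d_op_cong) (auto simp: D1_def)
    then show ?thesis using d_op_d_op_dd[OF assms x] by simp
  qed
  then show ?thesis by (auto simp: fun_eq_iff D2_def)
qed

text \<open>By \<open>d_op_d_op_contr\<close>, in whose right-hand side h occurs only through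
  \<open>dd n h\<close>.\<close>

lemma D2_contr_zero:
  assumes h: "ssmooth h" and D: "D1 h = 0"
  shows "D2 (contr B h) = 0"
proof -
  have "dd n h y As I = 0" if "y \<in> \<Omega>" for y As I
    using fun_cong[OF D, of y] that by (simp add: D1_def)
  then have "d_op n P0 (d_op n P1 (\<lambda>y. contr B h y As)) x K = 0" if "x \<in> \<Omega>" for x As K
    using that by (simp add: d_op_d_op_contr[OF h] d_op_eq_0 wedge_d_def)
  then show ?thesis by (auto simp: fun_eq_iff D2_def)
qed

lemma D2_lift:
  assumes "ssmooth f" "ssmooth g" "ssmooth v" "D1 f = - contr 1 v" "D1 g = contr 0 v"
  shows "D2 (contr 0 f + contr 1 g) = (\<lambda>x As K. zdet x * D1 v x As K)"
proof -
  have f: "dd n f y As I = - contr 1 v y As I" and g: "dd n g y As I = contr 0 v y As I"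
    if "y \<in> \<Omega>" for y As I
    using fun_cong[OF assms(4), of y] fun_cong[OF assms(5), of y] that by (auto simp: D1_def fun_eq_iff)
  have "d_op n P0 (d_op n P1 (\<lambda>y. (contr 0 f + contr 1 g) y As)) x K = zdet x * dd n v x As K"
    if "x \<in> \<Omega>" for x As K
    using d_op_d_op_lift[OF assms(1-3) that f g, of As K] by (simp only: plus_fun_def)
  then show ?thesis
    by (auto simp: fun_eq_iff D2_def D1_def simp del: plus_fun_apply One_nat_def)
qed

text \<open>Strings with different heads that are permutations of each other are both permutations
  of \<open>P0 # P1 # Cs\<close> with \<open>Cs = remove1 P1 As\<close>, and \<open>ab\<close> at
  \<open>Cs\<close> identifies their entries. Strings with equal heads have tails that are
  permutations of each other.\<close>

lemma symmetric_glue: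
  assumes a: "symmetric a" and b: "symmetric b" and ab: "\<And>x Bs. a x (P1 # Bs) = b x (P0 # Bs)"
  shows "symmetric (glue a b)"
proof -
  have cross: "glue a b x (P0 # As) = glue a b x (P1 # Bs)" if m: "mset (P0 # As) = mset (P1 # Bs)" for x As Bs
  proof -
    have eq: "add_mset P0 (mset As) = add_mset P1 (mset Bs)" using m by simp
    have "P1 \<in># add_mset P0 (mset As)" unfolding eq by simp
    then have As: "add_mset P1 (mset As - {#P1#}) = mset As" by (simp add: insert_DiffM)
    then have "add_mset P1 (add_mset P0 (mset As - {#P1#})) = add_mset P1 (mset Bs)"
      unfolding eq[symmetric] by (simp add: add_mset_commute)
    then have "add_mset P0 (mset As - {#P1#}) = mset Bs" by (simp only: add_mset_add_mset_same_iff)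
    then have "mset As = mset (P1 # remove1 P1 As)" "mset Bs = mset (P0 # remove1 P1 As)"
      using As by simp_all
    then have "a x As = a x (P1 # remove1 P1 As)" "b x Bs = b x (P0 # remove1 P1 As)"
      using a b unfolding symmetric_def by blast+
    then show ?thesis using ab by (simp add: glue_def fun_eq_iff)
  qed
  show ?thesis unfolding symmetric_def
  proof (intro allI impI)
    fix x As Bs assume m: "mset As = mset (Bs :: primed list)"
    show "glue a b x As = glue a b x Bs"
    proof (cases As)
      case (Cons P As')
      then obtain Q Bs' where B: "Bs = Q # Bs'" using m by (cases Bs) auto
      show ?thesis
      proof (cases "P = Q")
        case True
        then have "mset As' = mset Bs'" using m unfolding Cons B by simp
        then have "a x As' = a x Bs'" "b x As' = b x Bs'"
          using a b unfolding symmetric_def by blast+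
        then show ?thesis unfolding Cons B True by (cases Q) (simp_all add: glue_def fun_eq_iff)
      next
        case False
        then consider "P = P0" "Q = P1" | "P = P1" "Q = P0" by (cases P; cases Q) auto
        then show ?thesis
          by cases (metis cross m Cons B)+
      qed
    qed (use m in auto)
  qed
qed

lemma glue_SS:
  assumes a: "a \<in> SS p d" and b: "b \<in> SS p d" and ab: "\<And>x Bs. a x (P1 # Bs) = b x (P0 # Bs)"
  shows "glue a b \<in> SS (Suc p) d"
  unfolding SS_iff
proof (intro conjI allI impI)
  show "ssmooth (glue a b)"
    unfolding ssmooth_def esmooth_def
  proof (intro allI)
    fix As I show "smooth (\<lambda>x. glue a b x As I)"
      using SS_D(1)[OF a] SS_D(1)[OF b]
      by (cases As; cases "hd As") (auto simp: glue_def ssmooth_def esmooth_def)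
  qed
  show "symmetric (glue a b)" using symmetric_glue SS_D(2) assms by blast
  fix x As I assume "glue a b x As I \<noteq> 0"
  then obtain P Bs where "As = P # Bs" "a x Bs I \<noteq> 0 \<or> b x Bs I \<noteq> 0"
    by (auto simp: glue_def split: list.splits primed.splits)
  then show "x \<in> \<Omega>" "length As = Suc p" "I \<subseteq> {..<2 * n}" "card I = d"
    using SS_D(5)[OF a, of x Bs I] SS_D(5)[OF b, of x Bs I] by auto
qed

lemma sym_insert_SS:
  assumes f: "f \<in> SS p d" and w: "smooth w0" "smooth w1"
  shows "sym_insert w0 w1 f \<in> SS (Suc p) d"
  unfolding SS_iff
proof (intro conjI allI impI)
  show "ssmooth (sym_insert w0 w1 f)"
    unfolding ssmooth_def esmooth_def sym_insert_def divide_inverse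
    using w SS_D(1)[OF f] by (auto intro!: smooth_fun_mult smooth_fun_add simp: ssmooth_def esmooth_def)
  show "symmetric (sym_insert w0 w1 f)" unfolding symmetric_def
  proof (intro allI impI)
    fix x As Bs assume m: "mset As = mset (Bs :: primed list)"
    then have "mset (remove1 P As) = mset (remove1 P Bs)" for P by simp
    then have "f x (remove1 P As) = f x (remove1 P Bs)" for P
      using SS_D(2)[OF f] unfolding symmetric_def by blast
    then show "sym_insert w0 w1 f x As = sym_insert w0 w1 f x Bs"
      using m mset_eq_length[OF m] by (simp add: sym_insert_def fun_eq_iff)
  qed
  fix x As I assume "sym_insert w0 w1 f x As I \<noteq> 0"
  then have "of_nat (count (mset As) P0) * w0 x * f x (remove1 P0 As) I \<noteq> 0 \<or>
      of_nat (count (mset As) P1) * w1 x * f x (remove1 P1 As) I \<noteq> 0"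
    unfolding sym_insert_def by (metis add_0 div_0)
  then obtain P where "count (mset As) P \<noteq> 0" and P: "f x (remove1 P As) I \<noteq> 0"
    unfolding mult_eq_0_iff of_nat_eq_0_iff by blast
  then have "P \<in> set As" by (simp add: count_eq_zero_iff)
  then show "x \<in> \<Omega>" "length As = Suc p" "I \<subseteq> {..<2 * n}" "card I = d"
    using SS_D(5)[OF f P] length_pos_if_in_set[of P As] by (auto simp: length_remove1)
qed

definition DP :: "(point \<Rightarrow> symext) \<times> (point \<Rightarrow> symext) \<Rightarrow> (point \<Rightarrow> symext) \<times> (point \<Rightarrow> symext)" where
  "DP u = (D1 (fst u), D1 (snd u))"

lemma DP_SS: "u \<in> SS (Suc p) d \<times> SS (Suc p) d \<Longrightarrow> DP u \<in> SS p (Suc d) \<times> SS p (Suc d)"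
  by (auto simp: DP_def D1_SS)

lemma DP_diff: "u \<in> SS p d \<times> SS p d \<Longrightarrow> u' \<in> SS p d \<times> SS p d \<Longrightarrow> DP (u - u') = DP u - DP u'"
  by (auto simp: DP_def D1_diff SS_D)

lemma DP_add: "u \<in> SS p d \<times> SS p d \<Longrightarrow> u' \<in> SS p d \<times> SS p d \<Longrightarrow> DP (u + u') = DP u + DP u'"
  by (auto simp: DP_def D1_add SS_D)

lemma DP_DP: "u \<in> SS p d \<times> SS p d \<Longrightarrow> DP (DP u) = 0"
  by (auto simp: DP_def D1_D1 SS_D zero_prod_def)

lemma Lt_map_SS: "h \<in> SS (Suc p) d \<Longrightarrow> Lt_map h \<in> SS p d \<times> SS p d"
  by (auto simp: Lt_map_contr contr_SS SS_uminus)

lemma L_map_SS: "u \<in> SS (Suc p) d \<times> SS (Suc p) d \<Longrightarrow> L_map u \<in> SS p d"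
  by (auto simp: L_map_contr contr_SS SS_add)

lemma DP_Lt_map: "h \<in> SS p d \<Longrightarrow> DP (Lt_map h) = Lt_map (D1 h)"
  by (simp add: DP_def Lt_map_contr D1_uminus D1_contr SS_D ssmooth_contr)

lemma D1_L_map: "u \<in> SS p d \<times> SS p d \<Longrightarrow> D1 (L_map u) = L_map (DP u)"
  by (auto simp: DP_def L_map_contr D1_add D1_contr SS_D ssmooth_contr)

lemma L_map_Lt_map: "symmetric h \<Longrightarrow> L_map (Lt_map h) = 0"
  by (auto simp: L_map_def Lt_map_def fun_eq_iff symmetric_swap algebra_simps)

text \<open>Families without primed indices vanish at nonempty strings, the only ones that
  \<open>L_map\<close> reads. Hence the kernel condition of \<open>Lt_map_onto_kernel\<close> is
  automatic for D u in the case j = k, and \<open>Lt_map\<close> is onto there.\<close>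

lemma L_map_SS0: "u \<in> SS 0 d \<times> SS 0 d \<Longrightarrow> L_map u = 0"
proof -
  assume u: "u \<in> SS 0 d \<times> SS 0 d"
  have "fst u x (P # As) = 0" "snd u x (P # As) = 0" for x P As
    using u by (auto intro!: SS_D(4))
  then show ?thesis by (simp add: L_map_def fun_eq_iff)
qed

lemma smooth_zdet: "smooth zdet"
  unfolding zdet_def[abs_def] by (intro smooth_fun_diff smooth_fun_mult) simp_all

end

section \<open>Inverting the matrix z over the domain\<close>

locale quat_domain = quat_region +
  assumes zdet_nonzero: "x \<in> \<Omega> \<Longrightarrow> zdet x \<noteq> 0"
begin

lemma smooth_over_zdet: "smooth f \<Longrightarrow> smooth (\<lambda>x. f x * inverse (zdet x))"
  by (intro smooth_fun_mult smooth_fun_inverse smooth_zdet zdet_nonzero)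

lemma Lt_map_inj:
  assumes h: "h \<in> SS (Suc p) d" and L: "Lt_map h = 0"
  shows "h = 0"
proof (intro ext)
  fix x As I
  show "h x As I = 0 x As I"
  proof (rule ccontr)
    assume nz: "h x As I \<noteq> 0 x As I"
    then have s: "x \<in> \<Omega>" "length As = Suc p" using SS_D(5)[OF h] by auto
    then obtain P Bs where As: "As = P # Bs" by (cases As) auto
    define h0 h1 where "h0 = h x (P0 # Bs) I" and "h1 = h x (P1 # Bs) I"
    have e1: "- z_coord 1 P0 x * h0 - z_coord 1 P1 x * h1 = 0"
      and e2: "z_coord 0 P0 x * h0 + z_coord 0 P1 x * h1 = 0"
      using L by (auto simp: Lt_map_def zero_prod_def fun_eq_iff h0_def h1_def)
    \<comment> \<open>Cramer's rule for the system \<open>e1\<close>, \<open>e2\<close> in the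
      unknowns \<open>h0\<close>, \<open>h1\<close>.\<close>
    have "zdet x * h0 = z_coord 0 P1 x * (- z_coord 1 P0 x * h0 - z_coord 1 P1 x * h1)
        + z_coord 1 P1 x * (z_coord 0 P0 x * h0 + z_coord 0 P1 x * h1)"
      by (simp add: zdet_def algebra_simps)
    moreover have "zdet x * h1 = - z_coord 0 P0 x * (- z_coord 1 P0 x * h0 - z_coord 1 P1 x * h1)
        - z_coord 1 P0 x * (z_coord 0 P0 x * h0 + z_coord 0 P1 x * h1)"
      by (simp add: zdet_def algebra_simps)
    ultimately have "h0 = 0" "h1 = 0" using zdet_nonzero[OF s(1)] unfolding e1 e2 by auto
    then show False using nz unfolding As h0_def h1_def by (cases P) auto
  qed
qed

lemma Lt_map_cancel:
  assumes "h \<in> SS (Suc p) d" "h' \<in> SS (Suc p) d" "Lt_map h = Lt_map h'"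
  shows "h = h'"
  using Lt_map_inj[OF SS_diff[OF assms(1,2)]] assms(3) by simp

text \<open>Cramer's rule gives candidates \<open>a\<close> and \<open>b\<close> for the entries of
  h with first index 0' and 1'. They glue to a symmetric family once
  \<open>a x (P1 # Bs) = b x (P0 # Bs)\<close>, and the difference of these two is
  \<open>L_map u\<close> at \<open>Bs\<close> divided by \<open>zdet\<close>.\<close>

lemma Lt_map_onto_kernel:
  assumes u: "u \<in> SS p d \<times> SS p d" and L: "L_map u = 0"
  obtains h where "h \<in> SS (Suc p) d" "Lt_map h = u"
proof -
  obtain f g where fg: "u = (f, g)" "f \<in> SS p d" "g \<in> SS p d" using u by auto
  let ?i = "\<lambda>x. inverse (zdet x)"
  define a where "a = (\<lambda>x As I. (z_coord 0 P1 x * ?i x) * f x As I + (z_coord 1 P1 x * ?i x) * g x As I)"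
  define b where "b = (\<lambda>x As I. (- z_coord 0 P0 x * ?i x) * f x As I + (- z_coord 1 P0 x * ?i x) * g x As I)"
  have "a \<in> SS p d" unfolding a_def
    using fg by (intro SS_lin smooth_over_zdet) simp_all
  moreover have "b \<in> SS p d" unfolding b_def
    using fg by (intro SS_lin smooth_over_zdet smooth_fun_minus) simp_all
  moreover have "a x (P1 # Bs) = b x (P0 # Bs)" for x Bs
  proof
    fix I
    have e: "z_coord 0 P0 x * f x (P0 # Bs) I + z_coord 0 P1 x * f x (P1 # Bs) I +
        z_coord 1 P0 x * g x (P0 # Bs) I + z_coord 1 P1 x * g x (P1 # Bs) I = 0"
      using L fg(1) by (auto simp: L_map_def fun_eq_iff)
    have "a x (P1 # Bs) I - b x (P0 # Bs) I = ?i x *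
        (z_coord 0 P0 x * f x (P0 # Bs) I + z_coord 0 P1 x * f x (P1 # Bs) I +
        z_coord 1 P0 x * g x (P0 # Bs) I + z_coord 1 P1 x * g x (P1 # Bs) I)"
      by (simp add: a_def b_def algebra_simps)
    then show "a x (P1 # Bs) I = b x (P0 # Bs) I" unfolding e by simp
  qed
  ultimately have h: "glue a b \<in> SS (Suc p) d" by (rule glue_SS)
  have "Lt_map (glue a b) = u"
  proof -
    have "- z_coord 1 P0 x * a x As I - z_coord 1 P1 x * b x As I = f x As I \<and>
        z_coord 0 P0 x * a x As I + z_coord 0 P1 x * b x As I = g x As I" for x As I
    proof (cases "x \<in> \<Omega>")
      case True
      have "- z_coord 1 P0 x * a x As I - z_coord 1 P1 x * b x As I = (zdet x * ?i x) * f x As I"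
        "z_coord 0 P0 x * a x As I + z_coord 0 P1 x * b x As I = (zdet x * ?i x) * g x As I"
        by (simp_all add: a_def b_def zdet_def algebra_simps)
      then show ?thesis using zdet_nonzero[OF True] by simp
    next
      case False
      then show ?thesis using SS_D(3)[OF fg(2)] SS_D(3)[OF fg(3)] by (simp add: a_def b_def)
    qed
    then show ?thesis by (simp add: fg(1) Lt_map_def glue_def fun_eq_iff)
  qed
  with h show ?thesis by (rule that)
qed

text \<open>The lift of \<open>f\<close> is the symmetrisation of \<open>f \<otimes> w\<close>, where \<open>w\<close> is the inverse matrix of \<open>z\<close>.\<close>

lemma L_map_surj:
  assumes f: "f \<in> SS p d"
  obtains u where "u \<in> SS (Suc p) d \<times> SS (Suc p) d" "L_map u = f"
proof -
  define w00 w01 w10 w11 where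
    "w00 = (\<lambda>x. z_coord 1 P1 x * inverse (zdet x))" and "w01 = (\<lambda>x. - z_coord 1 P0 x * inverse (zdet x))" and
    "w10 = (\<lambda>x. - z_coord 0 P1 x * inverse (zdet x))" and "w11 = (\<lambda>x. z_coord 0 P0 x * inverse (zdet x))"
  let ?u = "(sym_insert w00 w01 f, sym_insert w10 w11 f)"
  have w: "smooth w00" "smooth w01" "smooth w10" "smooth w11"
    unfolding w00_def w01_def w10_def w11_def by (intro smooth_over_zdet smooth_fun_minus smooth_z_coord)+
  then have u: "?u \<in> SS (Suc p) d \<times> SS (Suc p) d" using sym_insert_SS[OF f] by simp
  have "L_map ?u x As I = f x As I" for x As I
  proof (cases "x \<in> \<Omega>")
    case True
    define a b where "a = (of_nat (count (mset As) P0) :: complex)" and "b = (of_nat (count (mset As) P1) :: complex)"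
    \<comment> \<open>X and Y are the entries of f in which the contracted index has replaced one
      index of \<open>As\<close>. Their coefficients are off-diagonal entries of z times its
      inverse, hence 0; the diagonal leaves (a + 1) + (b + 1) = l copies of F.\<close>
    define X Y where "X = f x (P0 # remove1 P1 As) I" and "Y = f x (P1 # remove1 P0 As) I"
    define F where "F = f x As I"
    define l where "l = (of_nat (length As + 2) :: complex)"
    have l: "l = a + b + 2" "l \<noteq> 0"
      unfolding l_def of_nat_eq_0_iff
      by (simp_all add: a_def b_def count_primed[of As, symmetric] del: count_mset)
    have "L_map ?u x As I =
       (z_coord 0 P0 x * ((a + 1) * w00 x * F + b * w01 x * X)
      + z_coord 0 P1 x * (a * w00 x * Y + (b + 1) * w01 x * F)
      + z_coord 1 P0 x * ((a + 1) * w10 x * F + b * w11 x * X)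
      + z_coord 1 P1 x * (a * w10 x * Y + (b + 1) * w11 x * F)) / l"
      by (simp add: L_map_def sym_insert_def a_def b_def l_def X_def Y_def F_def add_divide_distrib algebra_simps)
    also have "\<dots> = ((a + 1) * F * (z_coord 0 P0 x * w00 x + z_coord 1 P0 x * w10 x)
      + b * X * (z_coord 0 P0 x * w01 x + z_coord 1 P0 x * w11 x)
      + a * Y * (z_coord 0 P1 x * w00 x + z_coord 1 P1 x * w10 x)
      + (b + 1) * F * (z_coord 0 P1 x * w01 x + z_coord 1 P1 x * w11 x)) / l"
      by (simp add: algebra_simps)
    also have "z_coord 0 P0 x * w00 x + z_coord 1 P0 x * w10 x = zdet x * inverse (zdet x)"
      by (simp add: w00_def w10_def zdet_def algebra_simps)
    also have "z_coord 0 P0 x * w01 x + z_coord 1 P0 x * w11 x = 0"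
      by (simp add: w01_def w11_def)
    also have "z_coord 0 P1 x * w00 x + z_coord 1 P1 x * w10 x = 0"
      by (simp add: w00_def w10_def)
    also have "z_coord 0 P1 x * w01 x + z_coord 1 P1 x * w11 x = zdet x * inverse (zdet x)"
      by (simp add: w01_def w11_def zdet_def algebra_simps)
    also have "zdet x * inverse (zdet x) = 1" using zdet_nonzero[OF True] by simp
    also have "((a + 1) * F * 1 + b * X * 0 + a * Y * 0 + (b + 1) * F * 1) / l = F"
      using l(2) unfolding l(1) by (simp add: field_simps)
    finally show ?thesis by (simp add: F_def)
  next
    case False
    then show ?thesis using SS_D(3)[OF f] by (simp add: L_map_def sym_insert_def)
  qed
  then have "L_map ?u = f" by (simp add: fun_eq_iff)
  with u show ?thesis by (rule that)
qed

end

section \<open>The long exact sequence\<close>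

context quat_region
begin

abbreviation S :: "nat \<Rightarrow> nat \<Rightarrow> (point \<Rightarrow> symext) set" where
  "S m j \<equiv> SS (m - j) j"

abbreviation Z :: "nat \<Rightarrow> nat \<Rightarrow> (point \<Rightarrow> symext) set" where
  "Z m j \<equiv> carrier (cocycles n \<Omega> m j)"

abbreviation B :: "nat \<Rightarrow> nat \<Rightarrow> (point \<Rightarrow> symext) set" where
  "B m j \<equiv> coboundaries n \<Omega> m j"

lemma smooth_sections_CF: "j \<le> m \<Longrightarrow> smooth_sections n \<Omega> (CF_space n m j) = S m j"
  by (simp add: CF_space_def SS_def)

lemma Z_iff: "j \<le> m \<Longrightarrow> f \<in> Z m j \<longleftrightarrow> f \<in> S m j \<and> (if j < m then D1 f else D2 f) = 0"
  by (simp add: cocycles_def smooth_sections_CF CF_op_D zero_fun_def)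

lemma cocycles_add_monoid_on: "cocycles n \<Omega> m j = add_monoid_on (Z m j)"
proof -
  have "(\<lambda>f g x As I. f x As I + g x As I) = ((+) :: (point \<Rightarrow> symext) \<Rightarrow> _)"
    by (simp add: fun_eq_iff)
  then show ?thesis by (simp add: cocycles_def add_monoid_on_def zero_fun_def)
qed

lemma B_0: "B m 0 = {0}"
  by (simp add: coboundaries_def zero_fun_def)

lemma B_Suc: "Suc i \<le> m \<Longrightarrow> B m (Suc i) = D1 ` SS (Suc (m - Suc i)) i"
  by (auto simp: coboundaries_def smooth_sections_CF CF_op_D[abs_def] Suc_diff_Suc)

lemma add_subgroup_Z:
  assumes "j \<le> m"
  shows "add_subgroup (Z m j)"
  unfolding add_subgroup_def
proof (intro conjI ballI)
  show "0 \<in> Z m j" using assms by (simp add: Z_iff SS_zero)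
  fix f g assume "f \<in> Z m j" "g \<in> Z m j"
  then show "f - g \<in> Z m j"
    using assms by (auto simp: Z_iff SS_diff D1_diff D2_diff SS_D(1) split: if_splits)
qed

lemma B_subset_Z:
  assumes "j \<le> m"
  shows "B m j \<subseteq> Z m j"
proof (cases j)
  case 0
  then show ?thesis using add_subgroupD(1)[OF add_subgroup_Z[OF assms]] by (simp add: B_0)
next
  case (Suc i)
  then show ?thesis
    using assms by (auto simp: B_Suc Z_iff D1_SS D1_D1 D2_D1 SS_D(1,2))
qed

lemma add_subgroup_B:
  assumes "j \<le> m"
  shows "add_subgroup (B m j)"
proof (cases j)
  case 0
  then show ?thesis by (simp add: B_0 add_subgroup_def)
next
  case (Suc i)
  have "0 \<in> D1 ` SS (Suc (m - Suc i)) i" by (rule image_eqI[of _ _ 0]) (simp_all add: SS_zero)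
  moreover have "D1 f - D1 g \<in> D1 ` SS (Suc (m - Suc i)) i"
    if "f \<in> SS (Suc (m - Suc i)) i" "g \<in> SS (Suc (m - Suc i)) i" for f g
    using that by (intro image_eqI[of _ _ "f - g"]) (simp_all add: D1_diff SS_D(1) SS_diff)
  ultimately show ?thesis
    using assms Suc by (auto simp: B_Suc add_subgroup_def)
qed

lemma presents_cohom: "j \<le> m \<Longrightarrow> presents (cohom n \<Omega> m j) (Z m j) (B m j) (coh_class n \<Omega> m j)"
  using presents_Mod[OF add_subgroup_Z add_subgroup_B B_subset_Z, of j m]
  by (simp only: cohom_def coh_class_def[abs_def] cocycles_add_monoid_on[symmetric])

lemma presents_cohom2:
  "j \<le> m \<Longrightarrow> presents (cohom2 n \<Omega> m j) (Z m j \<times> Z m j) (B m j \<times> B m j) (coh_class2 n \<Omega> m j)"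
  unfolding cohom2_def coh_class2_def[abs_def]
  by (intro presents_DirProd presents_cohom)

lemma coh_class_eq: "coh_class n \<Omega> m j f = (\<lambda>b. b + f) ` B m j"
  using r_coset_add_monoid_on[of "Z m j" "B m j" f]
  by (simp only: coh_class_def cocycles_add_monoid_on[symmetric])

text \<open>For the source, closedness is first-order in all these degrees; for the target it
  becomes second-order at j = k + 1, and there the claim rests on
  \<open>D2_contr_zero\<close>.\<close>

lemma Lt_map_Z:
  assumes j: "j \<le> k + 1" and h: "h \<in> Z (k + 2) j"
  shows "Lt_map h \<in> Z (k + 1) j \<times> Z (k + 1) j"
proof -
  have hS: "h \<in> SS (Suc (k + 1 - j)) j" and D: "D1 h = 0"
    using h j by (auto simp: Z_iff Suc_diff_le)
  have "Lt_map h \<in> S (k + 1) j \<times> S (k + 1) j" using Lt_map_SS[OF hS] .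
  moreover have "DP (Lt_map h) = 0" using DP_Lt_map[OF hS] D by simp
  moreover have "D2 (contr B h) = 0" for B using D2_contr_zero[OF SS_D(1)[OF hS] D] .
  ultimately show ?thesis
    using j ssmooth_contr[OF SS_D(1)[OF hS]]
    by (auto simp: Z_iff DP_def Lt_map_contr D2_uminus zero_prod_def)
qed

lemma Lt_map_B:
  assumes j: "j \<le> k + 1" and b: "b \<in> B (k + 2) j"
  shows "Lt_map b \<in> B (k + 1) j \<times> B (k + 1) j"
proof (cases j)
  case 0
  then show ?thesis using b by (simp add: B_0 zero_prod_def)
next
  case (Suc i)
  then obtain w where w: "w \<in> SS (Suc (Suc (k + 1 - Suc i))) i" "b = D1 w"
    using b j by (auto simp: B_Suc Suc_diff_le)
  have "Lt_map b = DP (Lt_map w)" using DP_Lt_map[OF w(1)] w(2) by simp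
  then show ?thesis
    using Lt_map_SS[OF w(1)] j Suc by (auto simp: B_Suc DP_def)
qed

lemma L_map_B:
  assumes j: "j \<le> k" and u: "u \<in> B (k + 1) j \<times> B (k + 1) j"
  shows "L_map u \<in> B k j"
proof (cases j)
  case 0
  then have "u = 0" using u by (auto simp: B_0 zero_prod_def)
  then show ?thesis using 0 by (simp add: B_0)
next
  case (Suc i)
  have e: "k + 1 - Suc i = Suc (k - Suc i)" using j Suc by simp
  have "B (k + 1) j = D1 ` SS (Suc (Suc (k - Suc i))) i"
    using j Suc B_Suc[of i "k + 1"] by (simp only: e)
  then obtain a b where ab: "a \<in> SS (Suc (Suc (k - Suc i))) i" "b \<in> SS (Suc (Suc (k - Suc i))) i" "u = (D1 a, D1 b)"
    using u by auto
  then have w: "(a, b) \<in> SS (Suc (Suc (k - Suc i))) i \<times> SS (Suc (Suc (k - Suc i))) i" "u = DP (a, b)"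
    by (simp_all add: DP_def)
  have "L_map u = D1 (L_map (a, b))" using D1_L_map[OF w(1)] w(2) by simp
  then show ?thesis
    using L_map_SS[OF w(1)] j Suc by (simp add: B_Suc)
qed

end

section \<open>The connecting map and the diagram chases\<close>

context quat_domain
begin

text \<open>For \<open>j = k\<close> this is the identity \<open>\<D> (\<L> u) = \<bar>q\<^sub>0\<bar>\<^sup>2 \<D> v\<close>.\<close>

lemma L_map_cocycle_iff:
  assumes j: "j \<le> k" and u: "u \<in> S (k + 1) j \<times> S (k + 1) j" and v: "v \<in> S (k + 2) (j + 1)"
    and e: "Lt_map v = DP u"
  shows "L_map u \<in> Z k j \<longleftrightarrow> v \<in> Z (k + 2) (j + 1)"
proof -
  have u': "u \<in> SS (Suc (k - j)) j \<times> SS (Suc (k - j)) j" using u j by (simp add: Suc_diff_le)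
  have v': "v \<in> SS (Suc (k - j)) (Suc j)" using v j by (simp add: Suc_diff_le)
  have L: "L_map u \<in> S k j" using L_map_SS[OF u'] .
  have V: "v \<in> Z (k + 2) (j + 1) \<longleftrightarrow> D1 v = 0" using v j by (simp add: Z_iff)
  show ?thesis
  proof (cases "j < k")
    case True
    \<comment> \<open>Below degree k both sides are true: D(L u) = L(Lt v) = 0, and Lt(D v) = D(D u)
      = 0 with Lt injective.\<close>
    have "D1 (L_map u) = L_map (Lt_map v)" using D1_L_map[OF u] e by simp
    also have "\<dots> = 0" using L_map_Lt_map[OF SS_D(2)[OF v]] .
    finally have "L_map u \<in> Z k j" using L True by (simp add: Z_iff)
    moreover have "D1 v = 0"
    proof (rule Lt_map_inj)
      have "k - j = Suc (k - Suc j)" using True by simp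
      then show "D1 v \<in> SS (Suc (k - Suc j)) (Suc (Suc j))" using D1_SS[OF v'] by simp
      show "Lt_map (D1 v) = 0" using DP_Lt_map[OF v] DP_DP[OF u] e by simp
    qed
    ultimately show ?thesis using V by simp
  next
    case False
    have "D1 (fst u) = - contr 1 v" "D1 (snd u) = contr 0 v"
      using e by (simp_all add: DP_def Lt_map_contr)
    then have D: "D2 (L_map u) = (\<lambda>x As K. zdet x * D1 v x As K)"
      unfolding L_map_contr using u v by (intro D2_lift) (auto simp: SS_D(1))
    have "D1 v x As K = 0" if "D2 (L_map u) = 0" for x As K
    proof (cases "x \<in> \<Omega>")
      case True
      have "zdet x * D1 v x As K = 0" using fun_cong[OF fun_cong[OF fun_cong[OF that, of x], of As], of K] D by simp
      then show ?thesis using zdet_nonzero[OF True] by simp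
    qed (simp add: D1_def)
    then have "D2 (L_map u) = 0 \<longleftrightarrow> D1 v = 0" using D by (auto simp: fun_eq_iff)
    then show ?thesis using V L False j by (simp add: Z_iff)
  qed
qed

text \<open>The case v = 0 of \<open>L_map_cocycle_iff\<close>, as D u = 0 = Lt 0. For j = k this
  yields the second-order equation for L u.\<close>

lemma L_map_Z:
  assumes j: "j \<le> k" and u: "u \<in> Z (k + 1) j \<times> Z (k + 1) j"
  shows "L_map u \<in> Z k j"
proof -
  have u': "u \<in> S (k + 1) j \<times> S (k + 1) j" "DP u = 0"
    using u j by (auto simp: Z_iff DP_def zero_prod_def)
  have "0 \<in> Z (k + 2) (j + 1)" using add_subgroupD(1)[OF add_subgroup_Z] j by simp
  then show ?thesis
    using L_map_cocycle_iff[OF j u'(1) SS_zero] u'(2) by simp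
qed

lemma L_map_kernel:
  assumes j: "j \<le> k" and u: "u \<in> S (k + 1) j \<times> S (k + 1) j" and L: "L_map u = 0"
  obtains t where "t \<in> S (k + 2) j" "Lt_map t = u" "DP u = Lt_map (D1 t)"
proof -
  obtain t where t: "t \<in> SS (Suc (k + 1 - j)) j" "Lt_map t = u" using Lt_map_onto_kernel[OF u L] .
  show ?thesis using that[of t] t DP_Lt_map[OF t(1)] j by (simp add: Suc_diff_le)
qed

lemma Lt_map_cancel':
  assumes "j \<le> k + 1" "h \<in> S (k + 2) j" "h' \<in> S (k + 2) j" "Lt_map h = Lt_map h'"
  shows "h = h'"
  using Lt_map_cancel[of h "k + 1 - j" j h'] assms by (simp add: Suc_diff_le)

lemma D1_B: "j \<le> k \<Longrightarrow> t \<in> S (k + 2) j \<Longrightarrow> D1 t \<in> B (k + 2) (j + 1)"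
  by (auto simp: B_Suc Suc_diff_le)

lemma D1_S: "j \<le> k \<Longrightarrow> t \<in> S (k + 2) j \<Longrightarrow> D1 t \<in> S (k + 2) (j + 1)"
  using D1_SS[of t "k + 1 - j" j] by (simp add: Suc_diff_le)

text \<open>A primitive is lifted first and then differentiated. Since this lift is again a
  coboundary, it can correct a representative without changing its class.\<close>

lemma B_lift:
  assumes j: "j \<le> k" and f: "f \<in> B k j"
  obtains w where "w \<in> B (k + 1) j \<times> B (k + 1) j" "L_map w = f"
proof (cases j)
  case 0
  then have "0 \<in> B (k + 1) j \<times> B (k + 1) j" "f = 0" using f by (simp_all add: B_0 zero_prod_def)
  then show ?thesis using that[of 0] by simp
next
  case (Suc i)
  have e: "k + 1 - Suc i = Suc (k - Suc i)" using j Suc by simp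
  obtain g where g: "g \<in> SS (Suc (k - Suc i)) i" "f = D1 g" using f j Suc by (auto simp: B_Suc)
  obtain w where w: "w \<in> SS (Suc (Suc (k - Suc i))) i \<times> SS (Suc (Suc (k - Suc i))) i" "L_map w = g"
    using L_map_surj[OF g(1)] .
  show ?thesis
  proof (rule that[of "DP w"])
    have "B (k + 1) j = D1 ` SS (Suc (Suc (k - Suc i))) i"
      using j Suc B_Suc[of i "k + 1"] by (simp only: e)
    then show "DP w \<in> B (k + 1) j \<times> B (k + 1) j" using w(1) by (auto simp: DP_def)
    show "L_map (DP w) = f" using D1_L_map[OF w(1)] w(2) g(2) by simp
  qed
qed

lemma is_lift_iff:
  "j \<le> k \<Longrightarrow> is_lift n \<Omega> k j f u \<longleftrightarrow> u \<in> S (k + 1) j \<times> S (k + 1) j \<and> L_map u = f"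
  by (simp add: is_lift_def smooth_sections_CF)

lemma is_descent_iff:
  "j \<le> k \<Longrightarrow> is_descent n \<Omega> k j u v \<longleftrightarrow> v \<in> S (k + 2) (j + 1) \<and> Lt_map v = DP u"
  by (simp add: is_descent_def smooth_sections_CF CF_op_D DP_def)

text \<open>Many-valued, since the lift u is free; \<open>s_coh\<close> is the map that it induces
  on classes.\<close>

definition conn :: "nat \<Rightarrow> nat \<Rightarrow> (point \<Rightarrow> symext) \<Rightarrow> (point \<Rightarrow> symext) \<Rightarrow> bool" where
  "conn k j f v \<longleftrightarrow> (\<exists>u. is_lift n \<Omega> k j f u \<and> is_descent n \<Omega> k j u v)"

lemma conn_iff:
  "j \<le> k \<Longrightarrow> conn k j f v \<longleftrightarrow>
     (\<exists>u. u \<in> S (k + 1) j \<times> S (k + 1) j \<and> L_map u = f \<and> v \<in> S (k + 2) (j + 1) \<and> Lt_map v = DP u)"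
  by (auto simp: conn_def is_lift_iff is_descent_iff)

lemma ex_lift:
  assumes "j \<le> k" "f \<in> Z k j"
  shows "\<exists>u. is_lift n \<Omega> k j f u"
proof -
  have "f \<in> SS (k - j) j" using assms by (simp add: Z_iff)
  from L_map_surj[OF this] obtain u where
    "u \<in> SS (Suc (k - j)) j \<times> SS (Suc (k - j)) j" "L_map u = f" .
  then show ?thesis using assms by (auto simp: is_lift_iff Suc_diff_le)
qed

lemma ex1_descent:
  assumes j: "j \<le> k" and f: "f \<in> Z k j" and u: "is_lift n \<Omega> k j f u"
  shows "\<exists>!v. is_descent n \<Omega> k j u v"
proof -
  have uS: "u \<in> S (k + 1) j \<times> S (k + 1) j" and L: "L_map u = f" using u j by (auto simp: is_lift_iff)
  have DS: "DP u \<in> SS (k - j) (Suc j) \<times> SS (k - j) (Suc j)"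
    using DP_SS[of u "k - j" j] uS j by (simp add: Suc_diff_le)
  \<comment> \<open>For j < k this is closedness of f; for j = k no primed index is left in D u and
    the condition is empty.\<close>
  have "L_map (DP u) = 0"
  proof (cases "j < k")
    case True
    then show ?thesis using D1_L_map[OF uS] L f by (simp add: Z_iff)
  next
    case False
    then show ?thesis using L_map_SS0[of "DP u" "Suc j"] DS j by simp
  qed
  from Lt_map_onto_kernel[OF DS this] obtain v where "v \<in> SS (Suc (k - j)) (Suc j)" "Lt_map v = DP u" .
  then have v: "v \<in> S (k + 2) (j + 1)" "Lt_map v = DP u" using j by (simp_all add: Suc_diff_le)
  show ?thesis
  proof (rule ex1I[of _ v])
    show "is_descent n \<Omega> k j u v" using v j by (simp add: is_descent_iff)
    fix v' assume "is_descent n \<Omega> k j u v'"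
    then show "v' = v" using v j Lt_map_cancel'[of "j + 1" k v' v] by (simp add: is_descent_iff)
  qed
qed

lemma conn_Z: "j \<le> k \<Longrightarrow> f \<in> Z k j \<Longrightarrow> conn k j f v \<Longrightarrow> v \<in> Z (k + 2) (j + 1)"
  using L_map_cocycle_iff by (auto simp: conn_iff)

lemma conn_add:
  assumes j: "j \<le> k" and "conn k j f v" "conn k j f' v'"
  shows "conn k j (f + f') (v + v')"
proof -
  obtain u u' where u: "u \<in> S (k + 1) j \<times> S (k + 1) j" "L_map u = f" "v \<in> S (k + 2) (j + 1)" "Lt_map v = DP u"
    "u' \<in> S (k + 1) j \<times> S (k + 1) j" "L_map u' = f'" "v' \<in> S (k + 2) (j + 1)" "Lt_map v' = DP u'"
    using assms by (auto simp: conn_iff)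
  then show ?thesis
    using add_subgroupD(3)[OF add_subgroup_Times[OF add_subgroup_SS add_subgroup_SS] u(1,5)]
    unfolding conn_iff[OF j] by (intro exI[of _ "u + u'"]) (simp add: SS_add DP_add)
qed

lemma conn_diff:
  assumes j: "j \<le> k" and "conn k j f v" "conn k j f' v'"
  shows "conn k j (f - f') (v - v')"
proof -
  obtain u u' where u: "u \<in> S (k + 1) j \<times> S (k + 1) j" "L_map u = f" "v \<in> S (k + 2) (j + 1)" "Lt_map v = DP u"
    "u' \<in> S (k + 1) j \<times> S (k + 1) j" "L_map u' = f'" "v' \<in> S (k + 2) (j + 1)" "Lt_map v' = DP u'"
    using assms by (auto simp: conn_iff)
  then show ?thesis
    using add_subgroupD(4)[OF add_subgroup_Times[OF add_subgroup_SS add_subgroup_SS] u(1,5)]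
    unfolding conn_iff[OF j] by (intro exI[of _ "u - u'"]) (simp add: SS_diff DP_diff)
qed

text \<open>Two lifts of one section differ by some Lt t. Comparing an arbitrary lift with the
  closed lift u gives Lt v = Lt(D t), so v = D t. This yields both that s after L is zero and,
  through \<open>conn_B\<close>, independence of the lift.\<close>

lemma conn_L_map:
  assumes j: "j \<le> k" and u: "u \<in> Z (k + 1) j \<times> Z (k + 1) j" and c: "conn k j (L_map u) v"
  shows "v \<in> B (k + 2) (j + 1)"
proof -
  have uS: "u \<in> S (k + 1) j \<times> S (k + 1) j" and Du: "DP u = 0"
    using u j by (auto simp: Z_iff DP_def zero_prod_def)
  obtain u' where u': "u' \<in> S (k + 1) j \<times> S (k + 1) j" "L_map u' = L_map u" "v \<in> S (k + 2) (j + 1)" "Lt_map v = DP u'"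
    using c j by (auto simp: conn_iff)
  have d: "u' - u \<in> S (k + 1) j \<times> S (k + 1) j"
    using add_subgroupD(4)[OF add_subgroup_Times[OF add_subgroup_SS add_subgroup_SS] u'(1) uS] .
  obtain t where t: "t \<in> S (k + 2) j" "DP (u' - u) = Lt_map (D1 t)"
    using L_map_kernel[OF j d] u'(2) by auto
  have "Lt_map v = Lt_map (D1 t)" using t(2) u' Du DP_diff[OF u'(1) uS] by simp
  then have "v = D1 t" using Lt_map_cancel'[of "j + 1" k v "D1 t"] u'(3) D1_S[OF j t(1)] j by simp
  then show ?thesis using D1_B[OF j t(1)] by simp
qed

lemma conn_B:
  assumes j: "j \<le> k" and f: "f \<in> B k j" and c: "conn k j f v"
  shows "v \<in> B (k + 2) (j + 1)"
proof -
  obtain w where w: "w \<in> B (k + 1) j \<times> B (k + 1) j" "L_map w = f" using B_lift[OF j f] .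
  then have "w \<in> Z (k + 1) j \<times> Z (k + 1) j" using B_subset_Z[of j "k + 1"] j by auto
  then show ?thesis using conn_L_map[OF j] c w(2) by blast
qed

lemma Lt_coh_class:
  assumes j: "j \<le> k + 1" and h: "h \<in> Z (k + 2) j"
  shows "Lt_coh n \<Omega> k j (coh_class n \<Omega> (k + 2) j h) = coh_class2 n \<Omega> (k + 1) j (Lt_map h)"
  unfolding Lt_coh_def coh_class_eq[of "k + 2"]
proof (rule the_elem_constant)
  have sub: "B (k + 2) j \<subseteq> Z (k + 2) j" and Zs: "add_subgroup (Z (k + 2) j)"
    using j B_subset_Z add_subgroup_Z by simp_all
  have "0 \<in> B (k + 2) j" using add_subgroupD(1)[OF add_subgroup_B] j by simp
  then show "0 + h \<in> (\<lambda>b. b + h) ` B (k + 2) j" by (rule imageI)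
  fix h' assume "h' \<in> (\<lambda>b. b + h) ` B (k + 2) j"
  then obtain b where b: "b \<in> B (k + 2) j" "h' = b + h" by blast
  then have h': "h' \<in> Z (k + 2) j" using sub add_subgroupD(3)[OF Zs] h by blast
  have "Lt_map h' - Lt_map h = Lt_map b" using b(2) by simp
  then show "coh_class2 n \<Omega> (k + 1) j (Lt_map h') = coh_class2 n \<Omega> (k + 1) j (Lt_map h)"
    using presentsD(7)[OF presents_cohom2 Lt_map_Z[OF j h'] Lt_map_Z[OF j h]] Lt_map_B[OF j b(1)] j by simp
qed

lemma L_coh_class:
  assumes j: "j \<le> k" and u: "u \<in> Z (k + 1) j \<times> Z (k + 1) j"
  shows "L_coh n \<Omega> k j (coh_class2 n \<Omega> (k + 1) j u) = coh_class n \<Omega> k j (L_map u)"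
  unfolding L_coh_def coh_class2_def coh_class_eq[of "k + 1"] fst_conv snd_conv
proof (rule the_elem_constant)
  have sub: "B (k + 1) j \<subseteq> Z (k + 1) j" and Zs: "add_subgroup (Z (k + 1) j)"
    using j B_subset_Z add_subgroup_Z by simp_all
  have "0 \<in> B (k + 1) j" using add_subgroupD(1)[OF add_subgroup_B] j by simp
  then show "(0 + fst u, 0 + snd u) \<in> (\<lambda>b. b + fst u) ` B (k + 1) j \<times> (\<lambda>b. b + snd u) ` B (k + 1) j"
    by blast
  fix u' assume "u' \<in> (\<lambda>b. b + fst u) ` B (k + 1) j \<times> (\<lambda>b. b + snd u) ` B (k + 1) j"
  then obtain b where b: "b \<in> B (k + 1) j \<times> B (k + 1) j" "u' = b + u"
    by (auto simp: plus_prod_def)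
  have "b \<in> Z (k + 1) j \<times> Z (k + 1) j" using b(1) sub by auto
  then have u': "u' \<in> Z (k + 1) j \<times> Z (k + 1) j"
    using add_subgroupD(3)[OF add_subgroup_Times[OF Zs Zs] _ u] b(2) by simp
  have "L_map u' - L_map u = L_map b" using b(2) by simp
  then show "coh_class n \<Omega> k j (L_map u') = coh_class n \<Omega> k j (L_map u)"
    using presentsD(7)[OF presents_cohom L_map_Z[OF j u'] L_map_Z[OF j u]] L_map_B[OF j b(1)] j by simp
qed

lemma s_coh_class:
  assumes j: "j \<le> k" and f: "f \<in> Z k j" and c: "conn k j f v"
  shows "s_coh n \<Omega> k j (coh_class n \<Omega> k j f) = coh_class n \<Omega> (k + 2) (j + 1) v"
proof -
  have sub: "B k j \<subseteq> Z k j" and Zs: "add_subgroup (Z k j)"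
    using j B_subset_Z add_subgroup_Z by simp_all
  have "s_coh n \<Omega> k j (coh_class n \<Omega> k j f) =
      the_elem (coh_class n \<Omega> (k + 2) (j + 1) ` {v'. \<exists>f'\<in>coh_class n \<Omega> k j f. conn k j f' v'})"
    unfolding s_coh_def conn_def by (rule arg_cong[of _ _ the_elem]) blast
  also have "\<dots> = coh_class n \<Omega> (k + 2) (j + 1) v"
  proof (rule the_elem_constant)
    have "f \<in> coh_class n \<Omega> k j f"
      unfolding coh_class_eq
      using imageI[OF add_subgroupD(1)[OF add_subgroup_B[OF j]], of "\<lambda>b. b + f"] by simp
    then show "v \<in> {v'. \<exists>f'\<in>coh_class n \<Omega> k j f. conn k j f' v'}" using c by blast
    fix v' assume "v' \<in> {v'. \<exists>f'\<in>coh_class n \<Omega> k j f. conn k j f' v'}"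
    then obtain b where b: "b \<in> B k j" "conn k j (b + f) v'" unfolding coh_class_eq by blast
    have "b + f \<in> Z k j" using b(1) sub f add_subgroupD(3)[OF Zs] by blast
    then have "v' \<in> Z (k + 2) (j + 1)" using conn_Z[OF j] b(2) by blast
    \<comment> \<open>By additivity, independence of f and of u reduces to one fact: whatever is
      connected to a coboundary is a coboundary.\<close>
    moreover have "v' - v \<in> B (k + 2) (j + 1)"
      using conn_diff[OF j b(2) c] conn_B[OF j b(1)] by simp
    ultimately show "coh_class n \<Omega> (k + 2) (j + 1) v' = coh_class n \<Omega> (k + 2) (j + 1) v"
      using presentsD(7)[OF presents_cohom _ conn_Z[OF j f c]] j by simp
  qed
  finally show ?thesis .
qed

lemma induces_Lt_coh:
  "j \<le> k + 1 \<Longrightarrow> induces (Z (k + 2) j) (coh_class n \<Omega> (k + 2) j) (Z (k + 1) j \<times> Z (k + 1) j)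
     (coh_class2 n \<Omega> (k + 1) j) (\<lambda>h u. u = Lt_map h) (Lt_coh n \<Omega> k j)"
  unfolding induces_def using Lt_map_Z Lt_coh_class by simp

lemma induces_L_coh:
  "j \<le> k \<Longrightarrow> induces (Z (k + 1) j \<times> Z (k + 1) j) (coh_class2 n \<Omega> (k + 1) j) (Z k j)
     (coh_class n \<Omega> k j) (\<lambda>u f. f = L_map u) (L_coh n \<Omega> k j)"
  unfolding induces_def using L_map_Z L_coh_class by simp

lemma induces_s_coh:
  assumes "j \<le> k"
  shows "induces (Z k j) (coh_class n \<Omega> k j) (Z (k + 2) (j + 1))
     (coh_class n \<Omega> (k + 2) (j + 1)) (conn k j) (s_coh n \<Omega> k j)"
proof -
  have "\<exists>v. conn k j f v" if "f \<in> Z k j" for f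
    using ex_lift[OF assms that] ex1_descent[OF assms that] unfolding conn_def by blast
  then show ?thesis
    unfolding induces_def using assms conn_Z s_coh_class conn_add by auto
qed

lemma exact_at_pair:
  assumes j: "j \<le> k"
  shows "Lt_coh n \<Omega> k j ` carrier (cohom n \<Omega> (k + 2) j) =
    kernel (cohom2 n \<Omega> (k + 1) j) (cohom n \<Omega> k j) (L_coh n \<Omega> k j)"
proof (rule induces_exact[OF presents_cohom presents_cohom2 presents_cohom induces_Lt_coh induces_L_coh])
  fix x y w assume "x \<in> Z (k + 2) j" "y = Lt_map x" "w = L_map y"
  then have "w = 0" using j L_map_Lt_map[OF SS_D(2)] by (auto simp: Z_iff)
  then show "w \<in> B k j" using add_subgroupD(1)[OF add_subgroup_B[OF j]] by simp
next
  fix u w assume u: "u \<in> Z (k + 1) j \<times> Z (k + 1) j" and w: "w = L_map u" "w \<in> B k j"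
  \<comment> \<open>Subtracting b makes L vanish exactly and not just modulo coboundaries, so that u
    - b lies in the image of \<open>Lt_map\<close> on sections.\<close>
  obtain b where b: "b \<in> B (k + 1) j \<times> B (k + 1) j" "L_map b = w" using B_lift[OF j w(2)] .
  have bZ: "b \<in> Z (k + 1) j \<times> Z (k + 1) j" using b(1) B_subset_Z[of j "k + 1"] j by auto
  have S: "u \<in> S (k + 1) j \<times> S (k + 1) j" "b \<in> S (k + 1) j \<times> S (k + 1) j" and D: "DP u = 0" "DP b = 0"
    using u bZ j by (auto simp: Z_iff DP_def zero_prod_def)
  have d: "u - b \<in> S (k + 1) j \<times> S (k + 1) j"
    using add_subgroupD(4)[OF add_subgroup_Times[OF add_subgroup_SS add_subgroup_SS] S] .
  obtain t where t: "t \<in> S (k + 2) j" "Lt_map t = u - b" "DP (u - b) = Lt_map (D1 t)"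
    using L_map_kernel[OF j d] w(1) b(2) by auto
  have "Lt_map (D1 t) = Lt_map 0" using t(3) DP_diff[OF S] D by simp
  then have "D1 t = 0" using Lt_map_cancel'[OF _ D1_S[OF j t(1)] SS_zero] j by simp
  then have "t \<in> Z (k + 2) j" using t(1) j by (simp add: Z_iff)
  moreover have "u - Lt_map t \<in> B (k + 1) j \<times> B (k + 1) j" using t(2) b(1) by simp
  ultimately show "\<exists>x\<in>Z (k + 2) j. \<exists>y'. y' = Lt_map x \<and> u - y' \<in> B (k + 1) j \<times> B (k + 1) j"
    by (intro bexI[of _ t] exI conjI) (rule refl | assumption)+
qed (use j in simp_all)

lemma exact_at_quotient:
  assumes j: "j \<le> k"
  shows "L_coh n \<Omega> k j ` carrier (cohom2 n \<Omega> (k + 1) j) =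
    kernel (cohom n \<Omega> k j) (cohom n \<Omega> (k + 2) (j + 1)) (s_coh n \<Omega> k j)"
proof (rule induces_exact[OF presents_cohom2 presents_cohom presents_cohom induces_L_coh induces_s_coh])
  fix x y w assume "x \<in> Z (k + 1) j \<times> Z (k + 1) j" "y = L_map x" "conn k j y w"
  then show "w \<in> B (k + 2) (j + 1)" using conn_L_map[OF j] by blast
next
  fix f v assume f: "f \<in> Z k j" and c: "conn k j f v" and v: "v \<in> B (k + 2) (j + 1)"
  obtain u where u: "u \<in> S (k + 1) j \<times> S (k + 1) j" "L_map u = f" "Lt_map v = DP u"
    using c j by (auto simp: conn_iff)
  obtain t where t: "t \<in> SS (Suc (k + 1 - j)) j" "v = D1 t" using v j by (auto simp: B_Suc)
  have tu: "Lt_map t \<in> S (k + 1) j \<times> S (k + 1) j" using Lt_map_SS[OF t(1)] .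
  have d: "u - Lt_map t \<in> S (k + 1) j \<times> S (k + 1) j"
    using add_subgroupD(4)[OF add_subgroup_Times[OF add_subgroup_SS add_subgroup_SS] u(1) tu] .
  \<comment> \<open>As v = D t, correcting u by Lt t makes it closed without changing the section
    that it lifts.\<close>
  have "DP (u - Lt_map t) = 0" using DP_diff[OF u(1) tu] DP_Lt_map[OF t(1)] t(2) u(3) by simp
  then have "u - Lt_map t \<in> Z (k + 1) j \<times> Z (k + 1) j"
    using d j by (auto simp: Z_iff DP_def zero_prod_def mem_Times_iff)
  moreover have "f - L_map (u - Lt_map t) \<in> B k j"
    using L_map_Lt_map[OF SS_D(2)[OF t(1)]] u(2) add_subgroupD(1)[OF add_subgroup_B[OF j]] by simp
  ultimately show "\<exists>x\<in>Z (k + 1) j \<times> Z (k + 1) j. \<exists>y'. y' = L_map x \<and> f - y' \<in> B k j"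
    by (intro bexI[of _ "u - Lt_map t"] exI conjI) (rule refl | assumption)+
qed (use j in simp_all)

lemma exact_at_sub:
  assumes j: "j \<le> k"
  shows "s_coh n \<Omega> k j ` carrier (cohom n \<Omega> k j) =
    kernel (cohom n \<Omega> (k + 2) (j + 1)) (cohom2 n \<Omega> (k + 1) (j + 1)) (Lt_coh n \<Omega> k (j + 1))"
proof (rule induces_exact[OF presents_cohom presents_cohom presents_cohom2 induces_s_coh induces_Lt_coh])
  fix f v w assume "f \<in> Z k j" "conn k j f v" "w = Lt_map v"
  then obtain u where "u \<in> S (k + 1) j \<times> S (k + 1) j" "w = DP u" using j by (auto simp: conn_iff)
  then show "w \<in> B (k + 1) (j + 1) \<times> B (k + 1) (j + 1)"
    using j by (auto simp: B_Suc DP_def Suc_diff_le)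
next
  fix v w assume v: "v \<in> Z (k + 2) (j + 1)" and w: "w = Lt_map v" "w \<in> B (k + 1) (j + 1) \<times> B (k + 1) (j + 1)"
  then obtain u where u: "u \<in> S (k + 1) j \<times> S (k + 1) j" "Lt_map v = DP u"
    using j by (auto simp: B_Suc DP_def Suc_diff_le)
  have vS: "v \<in> S (k + 2) (j + 1)" using v j by (simp add: Z_iff)
  \<comment> \<open>The direction from v to L u of the equivalence: u need not be closed, but
    closedness of v makes L u a cocycle, for j = k by the second-order identity.\<close>
  have "L_map u \<in> Z k j" using L_map_cocycle_iff[OF j u(1) vS u(2)] v by simp
  moreover have "conn k j (L_map u) v" using u vS j by (auto simp: conn_iff)
  moreover have "v - v \<in> B (k + 2) (j + 1)" using add_subgroupD(1)[OF add_subgroup_B] j by simp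
  ultimately show "\<exists>x\<in>Z k j. \<exists>y'. conn k j x y' \<and> v - y' \<in> B (k + 2) (j + 1)"
    by blast
qed (use j in simp_all)

text \<open>In degree 0 the only coboundary is 0, so this is injectivity of \<open>Lt_map\<close> on
  sections.\<close>

lemma inj_on_Lt_coh_0: "inj_on (Lt_coh n \<Omega> k 0) (carrier (cohom n \<Omega> (k + 2) 0))"
proof (rule inj_onI)
  fix c c' assume c: "c \<in> carrier (cohom n \<Omega> (k + 2) 0)" "c' \<in> carrier (cohom n \<Omega> (k + 2) 0)"
    and e: "Lt_coh n \<Omega> k 0 c = Lt_coh n \<Omega> k 0 c'"
  obtain h h' where h: "h \<in> Z (k + 2) 0" "h' \<in> Z (k + 2) 0"
    "c = coh_class n \<Omega> (k + 2) 0 h" "c' = coh_class n \<Omega> (k + 2) 0 h'"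
    using c presentsD(5)[OF presents_cohom[of 0 "k + 2"]] by auto
  have "Lt_map h - Lt_map h' \<in> B (k + 1) 0 \<times> B (k + 1) 0"
    using e h Lt_coh_class[of 0 k] Lt_map_Z[of 0 k] presentsD(7)[OF presents_cohom2[of 0 "k + 1"]] by simp
  then have "Lt_map h = Lt_map h'" by (auto simp: B_0 prod_eq_iff)
  then have "h = h'" using Lt_map_cancel'[of 0 k h h'] h by (simp add: Z_iff)
  then show "c = c'" using h by simp
qed

end

theorem theorem1p6:
  fixes n k :: nat and \<Omega> :: "(nat \<Rightarrow> real) set"
  assumes "n \<ge> 1"
    and "openin (Euclidean_space (4 * n)) \<Omega>"
    and "connectedin (Euclidean_space (4 * n)) \<Omega>"
    and "\<Omega> \<noteq> {}"
    and "\<Omega> \<inter> {x. x 0 = 0 \<and> x 1 = 0 \<and> x 2 = 0 \<and> x 3 = 0} = {}"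
  shows "(\<forall>m\<in>{k, k + 1, k + 2}. \<forall>j\<le>min m (k + 1). coboundaries n \<Omega> m j \<lhd> cocycles n \<Omega> m j) \<and>
    (\<forall>j\<le>k + 1. \<forall>h\<in>carrier (cocycles n \<Omega> (k + 2) j).
       Lt_map h \<in> carrier (cocycles n \<Omega> (k + 1) j \<times>\<times> cocycles n \<Omega> (k + 1) j) \<and>
       Lt_coh n \<Omega> k j (coh_class n \<Omega> (k + 2) j h) = coh_class2 n \<Omega> (k + 1) j (Lt_map h)) \<and>
    (\<forall>j\<le>k. \<forall>u\<in>carrier (cocycles n \<Omega> (k + 1) j \<times>\<times> cocycles n \<Omega> (k + 1) j).
       L_map u \<in> carrier (cocycles n \<Omega> k j) \<and>
       L_coh n \<Omega> k j (coh_class2 n \<Omega> (k + 1) j u) = coh_class n \<Omega> k j (L_map u)) \<and>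
    (\<forall>j\<le>k. \<forall>f\<in>carrier (cocycles n \<Omega> k j).
       (\<exists>u. is_lift n \<Omega> k j f u) \<and>
       (\<forall>u. is_lift n \<Omega> k j f u \<longrightarrow> (\<exists>!v. is_descent n \<Omega> k j u v)) \<and>
       (\<forall>u v. is_lift n \<Omega> k j f u \<and> is_descent n \<Omega> k j u v \<longrightarrow>
          v \<in> carrier (cocycles n \<Omega> (k + 2) (j + 1)) \<and>
          s_coh n \<Omega> k j (coh_class n \<Omega> k j f) = coh_class n \<Omega> (k + 2) (j + 1) v)) \<and>
    (\<forall>j\<le>k + 1. group_hom (cohom n \<Omega> (k + 2) j) (cohom2 n \<Omega> (k + 1) j) (Lt_coh n \<Omega> k j)) \<and>
    (\<forall>j\<le>k. group_hom (cohom2 n \<Omega> (k + 1) j) (cohom n \<Omega> k j) (L_coh n \<Omega> k j)) \<and>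
    (\<forall>j\<le>k. group_hom (cohom n \<Omega> k j) (cohom n \<Omega> (k + 2) (j + 1)) (s_coh n \<Omega> k j)) \<and>
    inj_on (Lt_coh n \<Omega> k 0) (carrier (cohom n \<Omega> (k + 2) 0)) \<and>
    (\<forall>j\<le>k. Lt_coh n \<Omega> k j ` carrier (cohom n \<Omega> (k + 2) j) =
       kernel (cohom2 n \<Omega> (k + 1) j) (cohom n \<Omega> k j) (L_coh n \<Omega> k j)) \<and>
    (\<forall>j\<le>k. L_coh n \<Omega> k j ` carrier (cohom2 n \<Omega> (k + 1) j) =
       kernel (cohom n \<Omega> k j) (cohom n \<Omega> (k + 2) (j + 1)) (s_coh n \<Omega> k j)) \<and>
    (\<forall>j\<le>k. s_coh n \<Omega> k j ` carrier (cohom n \<Omega> k j) =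
       kernel (cohom n \<Omega> (k + 2) (j + 1)) (cohom2 n \<Omega> (k + 1) (j + 1)) (Lt_coh n \<Omega> k (j + 1)))"
proof -
  have "zdet x \<noteq> 0" if "x \<in> \<Omega>" for x
  proof -
    have "\<not> (x 0 = 0 \<and> x 1 = 0 \<and> x 2 = 0 \<and> x 3 = 0)" using assms(5) that by blast
    then have "(x 0)\<^sup>2 + (x 1)\<^sup>2 + (x 2)\<^sup>2 + (x 3)\<^sup>2 \<noteq> 0"
      by (simp add: add_nonneg_eq_0_iff)
    then show ?thesis unfolding zdet_eq of_real_eq_0_iff .
  qed
  then interpret quat_domain n \<Omega>
    by unfold_locales (use assms(2) in auto)
  have normal: "B m j \<lhd> cocycles n \<Omega> m j" if "j \<le> m" for m j
    using normal_add_monoid_on[OF add_subgroup_Z add_subgroup_B B_subset_Z] that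
    by (simp flip: cocycles_add_monoid_on)
  have carrier2: "carrier (cocycles n \<Omega> m j \<times>\<times> cocycles n \<Omega> m j) = Z m j \<times> Z m j" for m j
    by (simp add: DirProd_def)
  show ?thesis
    unfolding carrier2
  proof (intro conjI allI ballI impI)
    fix j u assume "j \<le> k" "u \<in> Z (k + 1) j \<times> Z (k + 1) j"
    then show "L_map u \<in> Z k j" "L_coh n \<Omega> k j (coh_class2 n \<Omega> (k + 1) j u) = coh_class n \<Omega> k j (L_map u)"
      using L_map_Z L_coh_class by blast+
  next
    fix j f u assume "j \<le> k" "f \<in> Z k j" "is_lift n \<Omega> k j f u"
    then show "\<exists>!v. is_descent n \<Omega> k j u v" by (rule ex1_descent)
  next
    fix j f u v assume "j \<le> k" "f \<in> Z k j" "is_lift n \<Omega> k j f u \<and> is_descent n \<Omega> k j u v"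
    then show "v \<in> Z (k + 2) (j + 1)"
      "s_coh n \<Omega> k j (coh_class n \<Omega> k j f) = coh_class n \<Omega> (k + 2) (j + 1) v"
      using conn_Z s_coh_class unfolding conn_def by blast+
  next
    fix j assume j: "j \<le> k"
    show "group_hom (cohom2 n \<Omega> (k + 1) j) (cohom n \<Omega> k j) (L_coh n \<Omega> k j)"
      using j by (intro induces_group_hom[OF presents_cohom2 presents_cohom induces_L_coh]) simp_all
    show "group_hom (cohom n \<Omega> k j) (cohom n \<Omega> (k + 2) (j + 1)) (s_coh n \<Omega> k j)"
      using j by (intro induces_group_hom[OF presents_cohom presents_cohom induces_s_coh]) simp_all
  next
    fix j assume j: "j \<le> k + 1"
    show "group_hom (cohom n \<Omega> (k + 2) j) (cohom2 n \<Omega> (k + 1) j) (Lt_coh n \<Omega> k j)"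
      using j by (intro induces_group_hom[OF presents_cohom presents_cohom2 induces_Lt_coh]) simp_all
  qed (use normal Lt_map_Z Lt_coh_class ex_lift exact_at_pair exact_at_quotient exact_at_sub inj_on_Lt_coh_0
      in \<open>auto simp del: One_nat_def\<close>)
qed

end
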